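(* Let $\mathfrak{A}$ be a unital AF algebra with unit $1_{\mathfrak{A}}$. Let $\mathcal{U}=(\mathfrak{A}_n)_{n\in\mathbb{N}}$ be an increasing sequence of unital finite dimensional C*-subalgebras such that $\mathfrak{A}=\overline{\cup_{n\in\mathbb{N}}\mathfrak{A}_n}^{\|\cdot\|_{\mathfrak{A}}}$ with $\mathfrak{A}_0=\mathbb{C}1_{\mathfrak{A}}$. Let $\mathfrak{B}$ be a unital AF algebra with unit $1_{\mathfrak{B}}$, and let $\mathcal{V}=(\mathfrak{B}_n)_{n\in\mathbb{N}}$ be an increasing sequence of unital finite dimensional C*-subalgebras such that $\mathfrak{B}=\overline{\cup_{n\in\mathbb{N}}\mathfrak{B}_n}^{\|\cdot\|_{\mathfrak{B}}}$ with $\mathfrak{B}_0=\mathbb{C}1_{\mathfrak{B}}$. Let $\beta:\mathbb{N}\to(0,\infty)$ have limit $0$ at infinity. Let $\mathsf{L}^\beta_{\mathcal{U}}$, $\mathsf{L}^\beta_{\mathcal{V}}$ denote the associated quotient-norm Lip-norms on $\mathfrak{A}$, $\mathfrak{B}$ respectively. If $\phi:\mathfrak{A}\hookrightarrow\mathfrak{B}$ is a unital *-monomorphism such that $\phi(\mathfrak{A}_n)=\mathfrak{B}_n$ for all $n\in\mathbb{N}$, then $\phi:(\mathfrak{A},\mathsf{L}^\beta_{\mathcal{U}})\to(\mathfrak{B},\mathsf{L}^\beta_{\mathcal{V}})$ is a quantum isometry and $$\mathsf{\Lambda}_{1,0}\left((\mathfrak{A},\mathsf{L}^\beta_{\mathcal{U}}),(\mathfrak{B},\mathsf{L}^\beta_{\mathcal{V}})\right)=0.$$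 Moreover, for all $n\in\mathbb{N}$, $$\mathsf{\Lambda}_{1,0}\left((\mathfrak{A}_n,\mathsf{L}^\beta_{\mathcal{U}}),(\mathfrak{B}_n,\mathsf{L}^\beta_{\mathcal{V}})\right)=0.$$
   Context: **The Lip-norms.** For $a\in\mathfrak{A}$, $\mathsf{L}^\beta_{\mathcal{U}}(a)=\sup\{S_n(a)/\beta(n):n\in\mathbb{N}\}\in[0,\infty]$, where $S_n(a)=\inf\{\|a-b\|_{\mathfrak{A}}:b\in\mathfrak{A}_n\}$ is the quotient norm of $\mathfrak{A}/\mathfrak{A}_n$; as a Lip-norm it is restricted to $\mathfrak{sa}(\mathfrak{A})$ (and to $\mathfrak{sa}(\mathfrak{A}_n)$ on $\mathfrak{A}_n$). $\mathsf{L}^\beta_{\mathcal{V}}$ is defined in the same way from $\mathfrak{B},\mathcal{V}$. The pairs $(\mathfrak{A},\mathsf{L}^\beta_{\mathcal{U}})$ and $(\mathfrak{A}_n,\mathsf{L}^\beta_{\mathcal{U}})$ are $(1,0)$-quasi-Leibniz quantum compact metric spaces. The subalgebras $\mathfrak{A}_n$ (resp. $\mathfrak{B}_n$) contain $1_{\mathfrak{A}}$ (resp. $1_{\mathfrak{B}}$). A quantum isometry $(\mathfrak{A},\mathsf{L}_{\mathfrak{A}})\to(\mathfrak{B},\mathsf{L}_{\mathfrak{B}})$ is a *-isomorphism $\pi:\mathfrak{A}\to\mathfrak{B}$ with $\mathsf{L}_{\mathfrak{B}}\circ\pi=\mathsf{L}_{\mathfrak{A}}$. **Quantum compact metric spaces.**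 For a unital C*-algebra $\mathfrak{A}$: $1_{\mathfrak{A}}$ is its unit, $\mathfrak{sa}(\mathfrak{A})$ its self-adjoint part, $\mathscr{S}(\mathfrak{A})$ its state space. For $C\geq1$, $D\geq0$, a $(C,D)$-quasi-Leibniz quantum compact metric space $(\mathfrak{A},\mathsf{L})$ is a unital C*-algebra $\mathfrak{A}$ with a seminorm $\mathsf{L}:\mathfrak{sa}(\mathfrak{A})\to[0,\infty]$ such that $\mathrm{dom}(\mathsf{L})=\{a\in\mathfrak{sa}(\mathfrak{A}):\mathsf{L}(a)<\infty\}$ is a dense unital Jordan-Lie subalgebra of $\mathfrak{sa}(\mathfrak{A})$ and: (i) $\{a:\mathsf{L}(a)=0\}=\mathbb{R}1_{\mathfrak{A}}$; (ii) for all $a,b\in\mathrm{dom}(\mathsf{L})$, $\max\{\mathsf{L}(\frac{ab+ba}{2}),\mathsf{L}(\frac{ab-ba}{2i})\}\leq C(\|a\|\mathsf{L}(b)+\|b\|\mathsf{L}(a))+D\mathsf{L}(a)\mathsf{L}(b)$; (iii) the metric $\mathsf{mk}_{\mathsf{L}}(\varphi,\psi)=\sup\{|\varphi(a)-\psi(a)|:a\in\mathrm{dom}(\mathsf{L}),\mathsf{L}(a)\leq1\}$ metrizes the weak* topology of $\mathscr{S}(\mathfrak{A})$; (iv) $\mathsf{L}$ is lower semi-continuous for $\|\cdot\|_{\mathfrak{A}}$. **Quantum propinquity.** A bridge $\gamma=(\mathfrak{D},\pi_{\mathfrak{A}},\pi_{\mathfrak{B}},\omega)$ from $\mathfrak{A}$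 to $\mathfrak{B}$ consists of a unital C*-algebra $\mathfrak{D}$, unital *-monomorphisms $\pi_{\mathfrak{A}}:\mathfrak{A}\to\mathfrak{D}$, $\pi_{\mathfrak{B}}:\mathfrak{B}\to\mathfrak{D}$ and $\omega\in\mathfrak{D}$ such that $\mathscr{S}_1(\mathfrak{D}|\omega)=\{\varphi\in\mathscr{S}(\mathfrak{D}):\varphi(1-\omega^*\omega)=\varphi(1-\omega\omega^* )=0\}\neq\emptyset$. Its height is the maximum of the Hausdorff distances, for $\mathsf{mk}_{\mathsf{L}_{\mathfrak{A}}}$ and $\mathsf{mk}_{\mathsf{L}_{\mathfrak{B}}}$ respectively, between $\mathscr{S}(\mathfrak{A})$ and $\{\varphi\circ\pi_{\mathfrak{A}}:\varphi\in\mathscr{S}_1(\mathfrak{D}|\omega)\}$, and between $\mathscr{S}(\mathfrak{B})$ and $\{\varphi\circ\pi_{\mathfrak{B}}:\varphi\in\mathscr{S}_1(\mathfrak{D}|\omega)\}$. Its reach is the Hausdorff distance between $\{a\in\mathfrak{sa}(\mathfrak{A}):\mathsf{L}_{\mathfrak{A}}(a)\leq1\}$ and $\{b\in\mathfrak{sa}(\mathfrak{B}):\mathsf{L}_{\mathfrak{B}}(b)\leq1\}$, where the distance from $a$ to $b$ is $\|\pi_{\mathfrak{A}}(a)\omega-\omega\pi_{\mathfrak{B}}(b)\|_{\mathfrak{D}}$. Its length is the maximum of height and reach. The quantum propinquity $\mathsf{\Lambda}_{C,D}$ is the largest $[0,\infty)$-valued function on pairs of $(C,D)$-quasi-Leibniz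 quantum compact metric spaces that is symmetric, satisfies the triangle inequality, and is at most the length of $\gamma$ for every bridge $\gamma$ between the two spaces (equivalently, the infimum, over finite chains of such spaces joined by bridges, of the sum of the lengths of the bridges). It is known to be zero exactly when there is a quantum isometry between the two spaces. *)

theory Defs
  imports "HOL-Analysis.Analysis" "HOL-Algebra.Subrings"
    "HOL-Algebra.Algebraic_Closure_Type"
begin

no_notation eq_closure_of ("closure'_of\<index>")

section \<open>Unital C*-algebras\<close>

text \<open>A C*-algebra is a structure on an explicit carrier, so that subalgebras, and the varying
  algebras occurring in bridges, are objects of the same kind. The scalars are the complex numbers,
  viewed as the ring \<^term>\<open>ring_of_type_algebra :: complex ring\<close>.\<close>

record 'a cstar = "(complex, 'a) module" +
  star :: "'a \<Rightarrow> 'a"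
  cnorm :: "'a \<Rightarrow> real"

text \<open>The value off the carrier is set to 0 because \<^locale>\<open>Metric_space\<close> requires nonnegativity and
  symmetry on the whole type.\<close>

definition cdist :: "'a cstar \<Rightarrow> 'a \<Rightarrow> 'a \<Rightarrow> real" where
  "cdist A a b = (if a \<in> carrier A \<and> b \<in> carrier A then cnorm A (a \<ominus>\<^bsub>A\<^esub> b) else 0)"

definition cstar_topology :: "'a cstar \<Rightarrow> 'a topology" where
  "cstar_topology A = Metric_space.mtopology (carrier A) (cdist A)"

text \<open>As usual, the unit of a unital C*-algebra is nonzero, i.e. the algebra is not \<open>{0}\<close>
  (which has no states).\<close>

locale cstar_algebra =
  ring A + Module.module "ring_of_type_algebra :: complex ring" A for A :: "'a cstar" (structure) +
  assumes one_neq_zero: "\<one> \<noteq> \<zero>"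
    and smult_mult_left: "\<And>c a b. a \<in> carrier A \<Longrightarrow> b \<in> carrier A \<Longrightarrow> (c \<odot> a) \<otimes> b = c \<odot> (a \<otimes> b)"
    and smult_mult_right: "\<And>c a b. a \<in> carrier A \<Longrightarrow> b \<in> carrier A \<Longrightarrow> a \<otimes> (c \<odot> b) = c \<odot> (a \<otimes> b)"
    and star_closed: "\<And>a. a \<in> carrier A \<Longrightarrow> star A a \<in> carrier A"
    and star_star: "\<And>a. a \<in> carrier A \<Longrightarrow> star A (star A a) = a"
    and star_add: "\<And>a b. a \<in> carrier A \<Longrightarrow> b \<in> carrier A \<Longrightarrow> star A (a \<oplus> b) = star A a \<oplus> star A b"
    and star_smult: "\<And>c a. a \<in> carrier A \<Longrightarrow> star A (c \<odot> a) = cnj c \<odot> star A a"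
    and star_mult: "\<And>a b. a \<in> carrier A \<Longrightarrow> b \<in> carrier A \<Longrightarrow> star A (a \<otimes> b) = star A b \<otimes> star A a"
    and cnorm_nonneg: "\<And>a. a \<in> carrier A \<Longrightarrow> 0 \<le> cnorm A a"
    and cnorm_eq_zero: "\<And>a. a \<in> carrier A \<Longrightarrow> cnorm A a = 0 \<longleftrightarrow> a = \<zero>"
    and cnorm_smult: "\<And>c a. a \<in> carrier A \<Longrightarrow> cnorm A (c \<odot> a) = cmod c * cnorm A a"
    and cnorm_triangle:
      "\<And>a b. a \<in> carrier A \<Longrightarrow> b \<in> carrier A \<Longrightarrow> cnorm A (a \<oplus> b) \<le> cnorm A a + cnorm A b"
    and cnorm_mult:
      "\<And>a b. a \<in> carrier A \<Longrightarrow> b \<in> carrier A \<Longrightarrow> cnorm A (a \<otimes> b) \<le> cnorm A a * cnorm A b"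
    and cstar_identity: "\<And>a. a \<in> carrier A \<Longrightarrow> cnorm A (star A a \<otimes> a) = (cnorm A a)\<^sup>2"
    and complete: "Metric_space.mcomplete (carrier A) (cdist A)"

definition sa :: "'a cstar \<Rightarrow> 'a set" where
  "sa A = {a \<in> carrier A. star A a = a}"

text \<open>A unital C*-subalgebra contains the unit of \<open>A\<close>, as \<^locale>\<open>subring\<close> requires. As an algebra in its own
  right, the subalgebra \<open>S\<close> is \<open>A\<lparr>carrier := S\<rparr>\<close>.\<close>

definition cstar_subalgebra :: "'a set \<Rightarrow> 'a cstar \<Rightarrow> bool" where
  "cstar_subalgebra S A \<longleftrightarrow>
     subring S A \<and> (\<forall>c. \<forall>a\<in>S. c \<odot>\<^bsub>A\<^esub> a \<in> S) \<and> (\<forall>a\<in>S. star A a \<in> S) \<and>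
     closedin (cstar_topology A) S"

definition finite_dim :: "'a set \<Rightarrow> 'a cstar \<Rightarrow> bool" where
  "finite_dim S A \<longleftrightarrow>
     (\<exists>F. finite F \<and> F \<subseteq> S \<and> (\<forall>a\<in>S. \<exists>c. a = (\<Oplus>\<^bsub>A\<^esub>x\<in>F. c x \<odot>\<^bsub>A\<^esub> x)))"

definition unital_star_hom :: "'a cstar \<Rightarrow> 'b cstar \<Rightarrow> ('a \<Rightarrow> 'b) \<Rightarrow> bool" where
  "unital_star_hom A B \<pi> \<longleftrightarrow>
     \<pi> \<in> ring_hom A B \<and>
     (\<forall>c. \<forall>a\<in>carrier A. \<pi> (c \<odot>\<^bsub>A\<^esub> a) = c \<odot>\<^bsub>B\<^esub> \<pi> a) \<and>
     (\<forall>a\<in>carrier A. \<pi> (star A a) = star B (\<pi> a))"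

definition unital_star_mono :: "'a cstar \<Rightarrow> 'b cstar \<Rightarrow> ('a \<Rightarrow> 'b) \<Rightarrow> bool" where
  "unital_star_mono A B \<pi> \<longleftrightarrow> unital_star_hom A B \<pi> \<and> inj_on \<pi> (carrier A)"

definition star_iso :: "'a cstar \<Rightarrow> 'b cstar \<Rightarrow> ('a \<Rightarrow> 'b) \<Rightarrow> bool" where
  "star_iso A B \<pi> \<longleftrightarrow> unital_star_hom A B \<pi> \<and> bij_betw \<pi> (carrier A) (carrier B)"

text \<open>States are positive linear functionals taking the value 1 at the unit. They are taken to be
  \<^const>\<open>extensional\<close> functions on the carrier, so that equality of states is equality of functions
  and the weak* topology is a subspace of a product topology.\<close>

definition states :: "'a cstar \<Rightarrow> ('a \<Rightarrow> complex) set" where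
  "states A = {f \<in> extensional (carrier A).
     (\<forall>a\<in>carrier A. \<forall>b\<in>carrier A. f (a \<oplus>\<^bsub>A\<^esub> b) = f a + f b) \<and>
     (\<forall>c. \<forall>a\<in>carrier A. f (c \<odot>\<^bsub>A\<^esub> a) = c * f a) \<and>
     (\<forall>a\<in>carrier A. f (star A a \<otimes>\<^bsub>A\<^esub> a) \<in> \<real>\<^sub>\<ge>\<^sub>0) \<and>
     f \<one>\<^bsub>A\<^esub> = 1}"

definition weak_star_topology :: "'a cstar \<Rightarrow> ('a \<Rightarrow> complex) topology" where
  "weak_star_topology A = subtopology (product_topology (\<lambda>_. euclidean) (carrier A)) (states A)"


section \<open>Quantum compact metric spaces\<close>

text \<open>A space is a pair of an algebra and a Lip-norm. Only the values of the Lip-norm on the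
  self-adjoint part are ever used; outside it is junk. In particular restricting the Lip-norm to a
  subalgebra does not change it as a function on the type.\<close>

type_synonym 'a space = "'a cstar \<times> ('a \<Rightarrow> ennreal)"

definition lip_dom :: "'a space \<Rightarrow> 'a set" where
  "lip_dom M = {a \<in> sa (fst M). snd M a < \<infinity>}"

definition lip_ball :: "'a space \<Rightarrow> 'a set" where
  "lip_ball M = {a \<in> sa (fst M). snd M a \<le> 1}"

definition mk :: "'a space \<Rightarrow> ('a \<Rightarrow> complex) \<Rightarrow> ('a \<Rightarrow> complex) \<Rightarrow> ennreal" where
  "mk M f g = (SUP a \<in> lip_ball M. ennreal (cmod (f a - g a)))"

definition jordan_prod :: "'a cstar \<Rightarrow> 'a \<Rightarrow> 'a \<Rightarrow> 'a" where
  "jordan_prod A a b = (1 / 2) \<odot>\<^bsub>A\<^esub> (a \<otimes>\<^bsub>A\<^esub> b \<oplus>\<^bsub>A\<^esub> b \<otimes>\<^bsub>A\<^esub> a)"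

definition lie_prod :: "'a cstar \<Rightarrow> 'a \<Rightarrow> 'a \<Rightarrow> 'a" where
  "lie_prod A a b = (1 / (2 * \<i>)) \<odot>\<^bsub>A\<^esub> (a \<otimes>\<^bsub>A\<^esub> b \<ominus>\<^bsub>A\<^esub> b \<otimes>\<^bsub>A\<^esub> a)"

text \<open>That \<^term>\<open>lip_dom (A, L)\<close> is a real subspace is part of the seminorm laws. Lower
  semicontinuity is expressed by closedness of the sublevel sets.\<close>

locale quasi_leibniz_qcms =
  fixes C D :: real and A :: "'a cstar" and L :: "'a \<Rightarrow> ennreal"
  assumes C_ge_1: "1 \<le> C" and D_ge_0: "0 \<le> D"
    and cstar: "cstar_algebra A"
    and L_triangle: "\<And>a b. a \<in> sa A \<Longrightarrow> b \<in> sa A \<Longrightarrow> L (a \<oplus>\<^bsub>A\<^esub> b) \<le> L a + L b"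
    and L_scale: "\<And>t a. a \<in> sa A \<Longrightarrow> L (complex_of_real t \<odot>\<^bsub>A\<^esub> a) = ennreal \<bar>t\<bar> * L a"
    and dom_dense: "sa A \<subseteq> cstar_topology A closure_of lip_dom (A, L)"
    and dom_one: "\<one>\<^bsub>A\<^esub> \<in> lip_dom (A, L)"
    and dom_jordan:
      "\<And>a b. a \<in> lip_dom (A, L) \<Longrightarrow> b \<in> lip_dom (A, L) \<Longrightarrow> jordan_prod A a b \<in> lip_dom (A, L)"
    and dom_lie:
      "\<And>a b. a \<in> lip_dom (A, L) \<Longrightarrow> b \<in> lip_dom (A, L) \<Longrightarrow> lie_prod A a b \<in> lip_dom (A, L)"
    and L_kernel: "{a \<in> sa A. L a = 0} = range (\<lambda>t. complex_of_real t \<odot>\<^bsub>A\<^esub> \<one>\<^bsub>A\<^esub>)"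
    and quasi_leibniz:
      "\<And>a b. a \<in> lip_dom (A, L) \<Longrightarrow> b \<in> lip_dom (A, L) \<Longrightarrow>
         max (L (jordan_prod A a b)) (L (lie_prod A a b))
           \<le> ennreal C * (ennreal (cnorm A a) * L b + ennreal (cnorm A b) * L a)
              + ennreal D * L a * L b"
    and mk_finite: "\<And>f g. f \<in> states A \<Longrightarrow> g \<in> states A \<Longrightarrow> mk (A, L) f g < \<infinity>"
    and mk_metric: "Metric_space (states A) (\<lambda>f g. enn2real (mk (A, L) f g))"
    and mk_metrizes:
      "Metric_space.mtopology (states A) (\<lambda>f g. enn2real (mk (A, L) f g)) = weak_star_topology A"
    and L_lsc: "\<And>r. closedin (subtopology (cstar_topology A) (sa A)) {a \<in> sa A. L a \<le> r}"

definition quantum_isometry :: "'a space \<Rightarrow> 'b space \<Rightarrow> ('a \<Rightarrow> 'b) \<Rightarrow> bool" where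
  "quantum_isometry M N \<pi> \<longleftrightarrow>
     star_iso (fst M) (fst N) \<pi> \<and> (\<forall>a\<in>sa (fst M). snd N (\<pi> a) = snd M a)"


section \<open>Bridges and the quantum propinquity\<close>

definition hausdorff :: "('a \<Rightarrow> 'b \<Rightarrow> ennreal) \<Rightarrow> 'a set \<Rightarrow> 'b set \<Rightarrow> ennreal" where
  "hausdorff d S T = max (SUP x\<in>S. INF y\<in>T. d x y) (SUP y\<in>T. INF x\<in>S. d x y)"

definition level_states :: "'d cstar \<Rightarrow> 'd \<Rightarrow> ('d \<Rightarrow> complex) set" where
  "level_states E w = {f \<in> states E.
     f (\<one>\<^bsub>E\<^esub> \<ominus>\<^bsub>E\<^esub> star E w \<otimes>\<^bsub>E\<^esub> w) = 0 \<and> f (\<one>\<^bsub>E\<^esub> \<ominus>\<^bsub>E\<^esub> w \<otimes>\<^bsub>E\<^esub> star E w) = 0}"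

definition bridge ::
  "'a cstar \<Rightarrow> 'b cstar \<Rightarrow> 'd cstar \<Rightarrow> ('a \<Rightarrow> 'd) \<Rightarrow> ('b \<Rightarrow> 'd) \<Rightarrow> 'd \<Rightarrow> bool" where
  "bridge A B E \<pi> \<rho> w \<longleftrightarrow>
     cstar_algebra E \<and> unital_star_mono A E \<pi> \<and> unital_star_mono B E \<rho> \<and>
     w \<in> carrier E \<and> level_states E w \<noteq> {}"

definition bridge_height ::
  "'a space \<Rightarrow> 'b space \<Rightarrow> 'd cstar \<Rightarrow> ('a \<Rightarrow> 'd) \<Rightarrow> ('b \<Rightarrow> 'd) \<Rightarrow> 'd \<Rightarrow> ennreal" where
  "bridge_height M N E \<pi> \<rho> w =
     max (hausdorff (mk M) (states (fst M))
            ((\<lambda>f. compose (carrier (fst M)) f \<pi>) ` level_states E w))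
         (hausdorff (mk N) (states (fst N))
            ((\<lambda>f. compose (carrier (fst N)) f \<rho>) ` level_states E w))"

definition bridge_reach ::
  "'a space \<Rightarrow> 'b space \<Rightarrow> 'd cstar \<Rightarrow> ('a \<Rightarrow> 'd) \<Rightarrow> ('b \<Rightarrow> 'd) \<Rightarrow> 'd \<Rightarrow> ennreal" where
  "bridge_reach M N E \<pi> \<rho> w =
     hausdorff (\<lambda>a b. ennreal (cnorm E (\<pi> a \<otimes>\<^bsub>E\<^esub> w \<ominus>\<^bsub>E\<^esub> w \<otimes>\<^bsub>E\<^esub> \<rho> b))) (lip_ball M) (lip_ball N)"

definition bridge_length ::
  "'a space \<Rightarrow> 'b space \<Rightarrow> 'd cstar \<Rightarrow> ('a \<Rightarrow> 'd) \<Rightarrow> ('b \<Rightarrow> 'd) \<Rightarrow> 'd \<Rightarrow> ennreal" where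
  "bridge_length M N E \<pi> \<rho> w = max (bridge_height M N E \<pi> \<rho> w) (bridge_reach M N E \<pi> \<rho> w)"

text \<open>\<open>bridge_chain C D M N r\<close>: there is a finite chain of bridges from \<open>M\<close> to \<open>N\<close> through
  \<open>(C, D)\<close>-quasi-Leibniz quantum compact metric spaces, of total length \<open>r\<close>. The end points are
  the arguments of the propinquity, for which being such spaces is presupposed.

  All intermediate spaces and bridge algebras live in the type of the end points. This loses nothing:
  a quantum compact metric space is separable, and a bridge algebra may be cut down to the separable
  C*-subalgebra generated by the two images and the pivot without changing the length (states of
  a C*-subalgebra extend). Separable C*-algebras have at most continuum many elements, while any
  type carrying one C*-algebra at all has at least that many, hence has room for copies of all of them.\<close>

inductive bridge_chain :: "real \<Rightarrow> real \<Rightarrow> 'a space \<Rightarrow> 'a space \<Rightarrow> ennreal \<Rightarrow> bool"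
  for C D :: real where
  single: "bridge (fst M) (fst N) (E :: 'a cstar) \<pi> \<rho> w \<Longrightarrow>
     bridge_chain C D M N (bridge_length M N E \<pi> \<rho> w)"
| step: "bridge (fst M) (fst Z) (E :: 'a cstar) \<pi> \<rho> w \<Longrightarrow>
     quasi_leibniz_qcms C D (fst Z) (snd Z) \<Longrightarrow>
     bridge_chain C D Z N r \<Longrightarrow>
     bridge_chain C D M N (bridge_length M Z E \<pi> \<rho> w + r)"

definition propinquity :: "real \<Rightarrow> real \<Rightarrow> 'a space \<Rightarrow> 'a space \<Rightarrow> ennreal" where
  "propinquity C D M N = Inf {r. bridge_chain C D M N r}"


section \<open>AF algebras and the quotient-norm Lip-norms\<close>

text \<open>\<open>af_filtration A U\<close>: \<open>A\<close> is a unital AF algebra, as exhibited by the sequence \<open>U\<close>.\<close>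

definition af_filtration :: "'a cstar \<Rightarrow> (nat \<Rightarrow> 'a set) \<Rightarrow> bool" where
  "af_filtration A U \<longleftrightarrow>
     cstar_algebra A \<and>
     (\<forall>n. cstar_subalgebra (U n) A \<and> finite_dim (U n) A) \<and>
     incseq U \<and>
     cstar_topology A closure_of (\<Union>n. U n) = carrier A \<and>
     U 0 = range (\<lambda>c. c \<odot>\<^bsub>A\<^esub> \<one>\<^bsub>A\<^esub>)"

definition quotient_norm :: "'a cstar \<Rightarrow> 'a set \<Rightarrow> 'a \<Rightarrow> real" where
  "quotient_norm A S a = (INF b\<in>S. cnorm A (a \<ominus>\<^bsub>A\<^esub> b))"

definition af_lipnorm :: "'a cstar \<Rightarrow> (nat \<Rightarrow> 'a set) \<Rightarrow> (nat \<Rightarrow> real) \<Rightarrow> 'a \<Rightarrow> ennreal" where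
  "af_lipnorm A U \<beta> a = (SUP n. ennreal (quotient_norm A (U n) a / \<beta> n))"

end

theory Submission
  imports Defs
begin

text \<open>In a finite-dimensional C*-algebra every self-adjoint \<open>h\<close> has an eigenprojection for an
  eigenvalue of modulus at least the norm of \<open>h\<close>. Since \<open>\<psi>\<close> and its inverse preserve eigenvectors,
  \<open>\<psi>\<close> is isometric on each \<open>U n\<close>. It is bounded on all of \<open>A\<close>: if the norm of \<open>a\<close> is at most
  \<open>1/2\<close>, then \<open>star a * a + star c * c = 1\<close> for some \<open>c\<close>, this equation is preserved by \<open>\<psi>\<close>, and in
  an AF algebra it bounds the norm of \<open>\<psi> a\<close> by \<open>1\<close>, by approximation from the \<open>V n\<close>. By density
  \<open>\<psi>\<close> is an isometric isomorphism, so it preserves the quotient norms. The trivial bridge given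
  by \<open>B\<close> and pivot \<open>1\<close> then has length \<open>0\<close>. It is a bridge because \<open>B\<close> has a state, which is built
  from a decreasing sequence of minimal projections.\<close>

section \<open>Algebra in C*-algebras\<close>

text \<open>A \<open>unital_star_mono\<close> is purely algebraic: nothing says that
  \<open>\<psi>\<close> is continuous, so an isometry on the dense union of the \<open>U n\<close>
  says nothing about its values at limit points, and extension by density cannot start until a bound
  on all of \<open>A\<close> is known. The usual bound compares spectra and uses the order on
  self-adjoint elements. Here both are replaced by elementary statements that survive a homomorphism
  or a limit: an eigenvector equation, and a sum of two squares equal to \<open>1\<close>. Powers of
  a self-adjoint element along the exponents \<open>2 ^ k\<close> take the place of the spectral
  radius formula. Positivity is read off from scalars: a minimal projection \<open>f\<close> of a
  finite-dimensional subalgebra turns each compression \<open>f y f\<close> into a number, which is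
  nonnegative when \<open>y\<close> has the form \<open>star a * a\<close>. The same scalars,
  followed along a decreasing sequence of minimal projections, are the values of the state that
  makes the trivial bridge legitimate; its restrictions serve the subalgebras
  \<open>V n\<close>.\<close>

lemma homogeneous_system_nontrivial_solution:
  fixes c :: "'i \<Rightarrow> 'f \<Rightarrow> 'k::field"
  assumes "finite F" "finite I" "card F < card I"
  shows "\<exists>d. (\<exists>i\<in>I. d i \<noteq> 0) \<and> (\<forall>x\<in>F. (\<Sum>i\<in>I. d i * c i x) = 0)"
  using assms
proof (induction F arbitrary: I c rule: finite_induct)
  case empty
  then show ?case by (intro exI[of _ "\<lambda>_. 1"]) (auto simp: card_gt_0_iff)
next
  case (insert y F)
  show ?case
  proof (cases "\<forall>i\<in>I. c i y = 0")
    case True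
    from insert.IH[of I c] insert.prems insert.hyps
    obtain d where d: "\<exists>i\<in>I. d i \<noteq> 0" "\<forall>x\<in>F. (\<Sum>i\<in>I. d i * c i x) = 0" by auto
    with True show ?thesis by (intro exI[of _ d]) auto
  next
    case False
    then obtain j where j: "j \<in> I" "c j y \<noteq> 0" by blast
    define I' where "I' = I - {j}"
    have I': "finite I'" "card F < card I'" "I = insert j I'" "j \<notin> I'"
      using insert.prems insert.hyps j by (auto simp: I'_def)
    from insert.IH[OF I'(1,2), of "\<lambda>i x. c i x - c i y / c j y * c j x"]
    obtain d where d: "\<exists>i\<in>I'. d i \<noteq> 0"
      "\<forall>x\<in>F. (\<Sum>i\<in>I'. d i * (c i x - c i y / c j y * c j x)) = 0" by blast
    \<comment> \<open>Gaussian elimination: the reduced system arises by solving equation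
      \<open>y\<close> for the unknown \<open>j\<close>, and the value restored at \<open>j\<close>
      is that solution.\<close>
    define e where "e = d(j := - (\<Sum>i\<in>I'. d i * c i y / c j y))"
    have sum_e: "(\<Sum>i\<in>I. e i * c i x) = (\<Sum>i\<in>I'. d i * (c i x - c i y / c j y * c j x))" for x
    proof -
      have "(\<Sum>i\<in>I. e i * c i x) = e j * c j x + (\<Sum>i\<in>I'. e i * c i x)"
        unfolding I'(3) using I'(1,4) by simp
      also have "(\<Sum>i\<in>I'. e i * c i x) = (\<Sum>i\<in>I'. d i * c i x)"
        using I'(4) by (intro sum.cong) (auto simp: e_def)
      also have "e j * c j x = - (\<Sum>i\<in>I'. d i * (c i y / c j y * c j x))"
        by (simp add: e_def sum_distrib_right mult.assoc)
      finally show ?thesis by (simp add: right_diff_distrib sum_subtractf)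
    qed
    have "(\<Sum>i\<in>I. e i * c i x) = 0" if "x \<in> insert y F" for x
      using that d(2) j(2) by (auto simp: sum_e)
    moreover have "\<exists>i\<in>I. e i \<noteq> 0"
      using d(1) I'(3,4) by (auto simp: e_def)
    ultimately show ?thesis by blast
  qed
qed

locale cstar = ring A for A :: "'a cstar" (structure) +
  assumes cstar_algebra: "cstar_algebra A"

lemma cstar_algebra_imp_cstar: "cstar_algebra A \<Longrightarrow> cstar A"
  unfolding cstar_def cstar_axioms_def by (auto simp: cstar_algebra_def)

context cstar
begin

lemma module_A: "Module.module (ring_of_type_algebra :: complex ring) A"
  using cstar_algebra by (simp add: cstar_algebra_def)

lemmas one_neq_zero [simp] = cstar_algebra.one_neq_zero [OF cstar_algebra]
lemmas smult_mult_left [simp] = cstar_algebra.smult_mult_left [OF cstar_algebra]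
lemmas smult_mult_right [simp] = cstar_algebra.smult_mult_right [OF cstar_algebra]
lemmas star_closed [simp, intro] = cstar_algebra.star_closed [OF cstar_algebra]
lemmas star_star [simp] = cstar_algebra.star_star [OF cstar_algebra]
lemmas star_add = cstar_algebra.star_add [OF cstar_algebra]
lemmas star_smult = cstar_algebra.star_smult [OF cstar_algebra]
lemmas star_mult = cstar_algebra.star_mult [OF cstar_algebra]
lemmas cnorm_nonneg [simp] = cstar_algebra.cnorm_nonneg [OF cstar_algebra]
lemmas cnorm_eq_zero [simp] = cstar_algebra.cnorm_eq_zero [OF cstar_algebra]
lemmas cnorm_smult = cstar_algebra.cnorm_smult [OF cstar_algebra]
lemmas cnorm_triangle = cstar_algebra.cnorm_triangle [OF cstar_algebra]
lemmas cnorm_mult = cstar_algebra.cnorm_mult [OF cstar_algebra]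
lemmas cstar_identity = cstar_algebra.cstar_identity [OF cstar_algebra]
lemmas mcomplete_A = cstar_algebra.complete [OF cstar_algebra]

lemma smult_closed [simp, intro]: "a \<in> carrier A \<Longrightarrow> c \<odot> a \<in> carrier A"
  using module.smult_closed[OF module_A, of c a] by (simp add: ring_of_type_algebra_def)

lemma smult_add_left: "a \<in> carrier A \<Longrightarrow> (c + d) \<odot> a = c \<odot> a \<oplus> d \<odot> a"
  using module.smult_l_distr[OF module_A, of c d a] by (simp add: ring_of_type_algebra_def)

lemma smult_add_right: "a \<in> carrier A \<Longrightarrow> b \<in> carrier A \<Longrightarrow> c \<odot> (a \<oplus> b) = c \<odot> a \<oplus> c \<odot> b"
  using module.smult_r_distr[OF module_A, of c a b] by (simp add: ring_of_type_algebra_def)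

lemma smult_smult [simp]: "a \<in> carrier A \<Longrightarrow> c \<odot> (d \<odot> a) = (c * d) \<odot> a"
  using module.smult_assoc1[OF module_A, of c d a] by (simp add: ring_of_type_algebra_def)

lemma smult_1 [simp]: "a \<in> carrier A \<Longrightarrow> 1 \<odot> a = a"
  using module.smult_one[OF module_A, of a] by (simp add: ring_of_type_algebra_def)

lemma smult_0 [simp]: "a \<in> carrier A \<Longrightarrow> 0 \<odot> a = \<zero>"
  using module.smult_l_null[OF module_A, of a] by (simp add: ring_of_type_algebra_def)

lemma smult_zero [simp]: "c \<odot> \<zero> = \<zero>"
  using smult_smult[of \<zero> c 0] by simp

lemma uminus_smult: "a \<in> carrier A \<Longrightarrow> \<ominus> a = (-1) \<odot> a"
  using smult_add_left[of a 1 "-1"] by (simp add: minus_equality a_comm)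

lemma diff_self [simp]: "a \<in> carrier A \<Longrightarrow> a \<ominus> a = \<zero>"
  by (simp add: minus_eq r_neg)

lemma diff_smult: "a \<in> carrier A \<Longrightarrow> b \<in> carrier A \<Longrightarrow> a \<ominus> b = a \<oplus> (-1) \<odot> b"
  by (simp add: minus_eq uminus_smult)

lemma diff_smult': "a \<in> carrier A \<Longrightarrow> b \<in> carrier A \<Longrightarrow> a \<ominus> c \<odot> b = a \<oplus> (-c) \<odot> b"
  by (simp add: diff_smult)

lemma smult_diff: "a \<in> carrier A \<Longrightarrow> b \<in> carrier A \<Longrightarrow> c \<odot> (a \<ominus> b) = c \<odot> a \<ominus> c \<odot> b"
  by (simp add: diff_smult smult_add_right)

lemma smult_diff_left: "a \<in> carrier A \<Longrightarrow> (c - d) \<odot> a = c \<odot> a \<ominus> d \<odot> a"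
  using smult_add_left[of a c "- d"] by (simp add: diff_smult)

lemma smult_eq_zero: "a \<in> carrier A \<Longrightarrow> c \<odot> a = \<zero> \<longleftrightarrow> c = 0 \<or> a = \<zero>"
  by (metis cnorm_eq_zero cnorm_smult mult_eq_0_iff norm_eq_zero smult_closed)

lemma smult_cancel: "a \<in> carrier A \<Longrightarrow> a \<noteq> \<zero> \<Longrightarrow> c \<odot> a = d \<odot> a \<longleftrightarrow> c = d"
  by (metis smult_closed smult_diff_left smult_eq_zero r_right_minus_eq right_minus_eq)

lemma star_one [simp]: "star A \<one> = \<one>"
  using star_mult[of "star A \<one>" "\<one>"] by (metis star_closed star_star one_closed r_one)

lemma star_zero [simp]: "star A \<zero> = \<zero>"
  using star_smult[of \<zero> 0] by simp

lemma star_diff: "a \<in> carrier A \<Longrightarrow> b \<in> carrier A \<Longrightarrow> star A (a \<ominus> b) = star A a \<ominus> star A b"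
  by (simp add: diff_smult star_add star_smult)

lemma cnorm_zero [simp]: "cnorm A \<zero> = 0"
  by simp

lemma cnorm_uminus: "a \<in> carrier A \<Longrightarrow> cnorm A (\<ominus> a) = cnorm A a"
  by (simp add: uminus_smult cnorm_smult)

lemma cnorm_diff_commute: "a \<in> carrier A \<Longrightarrow> b \<in> carrier A \<Longrightarrow> cnorm A (a \<ominus> b) = cnorm A (b \<ominus> a)"
proof -
  assume "a \<in> carrier A" "b \<in> carrier A"
  moreover from this have "b \<ominus> a = \<ominus> (a \<ominus> b)" by algebra
  ultimately show ?thesis by (simp add: cnorm_uminus)
qed

lemma cnorm_diff_triangle:
  assumes "a \<in> carrier A" "b \<in> carrier A" "c \<in> carrier A"
  shows "cnorm A (a \<ominus> c) \<le> cnorm A (a \<ominus> b) + cnorm A (b \<ominus> c)"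
proof -
  have "a \<ominus> c = (a \<ominus> b) \<oplus> (b \<ominus> c)" using assms by algebra
  then show ?thesis using assms cnorm_triangle[of "a \<ominus> b" "b \<ominus> c"] by simp
qed

lemma abs_cnorm_diff_le:
  assumes "a \<in> carrier A" "b \<in> carrier A"
  shows "\<bar>cnorm A a - cnorm A b\<bar> \<le> cnorm A (a \<ominus> b)"
proof -
  have "a = (a \<ominus> b) \<oplus> b" "b = (b \<ominus> a) \<oplus> a" using assms by algebra+
  then have "cnorm A a \<le> cnorm A (a \<ominus> b) + cnorm A b" "cnorm A b \<le> cnorm A (b \<ominus> a) + cnorm A a"
    using assms by (metis cnorm_triangle minus_closed)+
  then show ?thesis using cnorm_diff_commute[OF assms] by simp
qed

text \<open>The C*-identity bounds the square of \<open>cnorm A a\<close> by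
  \<open>cnorm A (star A a) * cnorm A a\<close>, and a nonzero norm cancels. Applied to
  \<open>star A a\<close> as well, this makes the star isometric.\<close>

lemma cnorm_le_cnorm_star:
  assumes "a \<in> carrier A"
  shows "cnorm A a \<le> cnorm A (star A a)"
proof (cases "cnorm A a = 0")
  case False
  then have "0 < cnorm A a" using assms cnorm_nonneg[of a] by linarith
  moreover have "cnorm A a * cnorm A a \<le> cnorm A (star A a) * cnorm A a"
    using cstar_identity[OF assms] cnorm_mult[of "star A a" a] assms by (simp add: power2_eq_square)
  ultimately show ?thesis by (rule mult_right_le_imp_le[rotated])
qed (use assms in simp)

lemma cnorm_star [simp]: "a \<in> carrier A \<Longrightarrow> cnorm A (star A a) = cnorm A a"
  by (metis cnorm_le_cnorm_star order_antisym star_closed star_star)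

lemma star_mult_eq_zero: "a \<in> carrier A \<Longrightarrow> star A a \<otimes> a = \<zero> \<Longrightarrow> a = \<zero>"
  using cstar_identity[of a] by simp

text \<open>For self-adjoint \<open>g\<close> the square \<open>g \<otimes> g\<close> is
  \<open>star A g \<otimes> g\<close>, so the C*-identity computes its norm exactly; iterating
  explains the exponents \<open>2 ^ k\<close>. These values are later played against an upper bound
  on the growth of powers.\<close>

lemma cnorm_self_adjoint_power:
  assumes "h \<in> carrier A" "star A h = h"
  shows "star A (h [^] (2 ^ k :: nat)) = h [^] (2 ^ k :: nat) \<and>
    cnorm A (h [^] (2 ^ k :: nat)) = cnorm A h ^ (2 ^ k)"
proof (induction k)
  case (Suc k)
  let ?g = "h [^] (2 ^ k :: nat)"
  have eq: "h [^] (2 ^ Suc k :: nat) = ?g \<otimes> ?g"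
    using assms by (simp add: nat_pow_mult mult_2)
  have g: "?g \<in> carrier A" using assms by simp
  show ?case using Suc cstar_identity[OF g] g
    unfolding eq by (simp add: star_mult power2_eq_square mult_2 power_add)
qed (use assms in auto)

subsection \<open>Spectral theory in finite dimension\<close>

definition projection :: "'a \<Rightarrow> bool" where
  "projection e \<longleftrightarrow> e \<in> carrier A \<and> e \<otimes> e = e \<and> star A e = e"

lemma cnorm_projection: "projection e \<Longrightarrow> e \<noteq> \<zero> \<Longrightarrow> cnorm A e = 1"
  using cstar_identity[of e] by (auto simp: projection_def power2_eq_square)

lemma projection_one: "projection \<one>"
  by (simp add: projection_def)

lemma cnorm_one [simp]: "cnorm A \<one> = 1"
  using cnorm_projection[OF projection_one] by simp

text \<open>This is the polynomial functional calculus in Horner form, with a constant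
  \<open>c\<close> embedded as \<open>c \<odot> \<one>\<close>; the recursion on
  \<open>pCons\<close> turns most laws below into inductions over coefficients.\<close>

definition ev :: "'a \<Rightarrow> complex poly \<Rightarrow> 'a" where
  "ev h P = fold_coeffs (\<lambda>c z. c \<odot> \<one> \<oplus> h \<otimes> z) P \<zero>"

lemma ev_0 [simp]: "ev h 0 = \<zero>"
  by (simp add: ev_def)

lemma ev_pCons:
  assumes "h \<in> carrier A"
  shows "ev h (pCons c P) = c \<odot> \<one> \<oplus> h \<otimes> ev h P"
proof (cases "P = 0 \<and> c = 0")
  case False
  then show ?thesis by (cases "c = 0") (auto simp: ev_def)
qed (use assms in auto)

lemma ev_closed [simp, intro]: "h \<in> carrier A \<Longrightarrow> ev h P \<in> carrier A"
  by (induction P) (auto simp: ev_pCons)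

lemma ev_add: "h \<in> carrier A \<Longrightarrow> ev h (P + Q) = ev h P \<oplus> ev h Q"
proof (induction P Q rule: poly_induct2)
  case (pCons a p b q)
  have "ev h (pCons a p + pCons b q) = (a \<odot> \<one> \<oplus> b \<odot> \<one>) \<oplus> h \<otimes> (ev h p \<oplus> ev h q)"
    using pCons by (simp add: ev_pCons smult_add_left)
  also have "\<dots> = (a \<odot> \<one> \<oplus> h \<otimes> ev h p) \<oplus> (b \<odot> \<one> \<oplus> h \<otimes> ev h q)"
    using pCons smult_closed[OF one_closed, of a] smult_closed[OF one_closed, of b]
      ev_closed[of h p] ev_closed[of h q] by algebra
  finally show ?case using pCons by (simp add: ev_pCons)
qed simp

lemma ev_smult: "h \<in> carrier A \<Longrightarrow> ev h (Polynomial.smult c P) = c \<odot> ev h P"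
  by (induction P) (auto simp: ev_pCons smult_add_right)

lemma ev_monom: "h \<in> carrier A \<Longrightarrow> ev h (Polynomial.monom c n) = c \<odot> h [^] n"
proof (induction n)
  case (Suc n)
  then show ?case using nat_pow_Suc2[of h n] by (simp add: monom_Suc ev_pCons)
qed (simp add: monom_0 ev_pCons)

lemma ev_sum_monom:
  assumes "h \<in> carrier A"
  shows "ev h (\<Sum>i\<le>n. Polynomial.monom (d i) i) = (\<Oplus>i\<in>{..n}. d i \<odot> h [^] i)"
proof (induction n)
  case (Suc n)
  have "(\<Oplus>i\<in>{..Suc n}. d i \<odot> h [^] i) = d (Suc n) \<odot> h [^] Suc n \<oplus> (\<Oplus>i\<in>{..n}. d i \<odot> h [^] i)"
    using assms by (intro finsum_Suc) (auto simp del: nat_pow_Suc)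
  with Suc show ?case using assms by (simp add: ev_add ev_monom a_comm del: nat_pow_Suc)
qed (use assms in \<open>simp add: ev_monom\<close>)

lemma ev_commute: "h \<in> carrier A \<Longrightarrow> h \<otimes> ev h P = ev h P \<otimes> h"
proof (induction P)
  case (pCons a p)
  have "h \<otimes> ev h (pCons a p) = a \<odot> h \<oplus> h \<otimes> (h \<otimes> ev h p)"
    using pCons by (simp add: ev_pCons r_distr)
  also have "h \<otimes> (h \<otimes> ev h p) = (h \<otimes> ev h p) \<otimes> h"
    using pCons by (metis m_assoc ev_closed)
  also have "a \<odot> h \<oplus> (h \<otimes> ev h p) \<otimes> h = ev h (pCons a p) \<otimes> h"
    using pCons by (simp add: ev_pCons l_distr)
  finally show ?case .
qed simp

lemma ev_linear_factor:
  assumes "h \<in> carrier A"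
  shows "ev h ([:- l, 1:] * Q) = h \<otimes> ev h Q \<ominus> l \<odot> ev h Q"
proof -
  have "[:- l, 1:] * Q = pCons 0 Q + Polynomial.smult (- l) Q" by simp
  then show ?thesis using assms by (simp only: ev_add ev_smult) (simp add: ev_pCons diff_smult')
qed

lemma ev_eigenvector:
  assumes "h \<in> carrier A" "u \<in> carrier A" "h \<otimes> u = l \<odot> u"
  shows "ev h P \<otimes> u = poly P l \<odot> u"
proof (induction P)
  case (pCons a p)
  have "ev h (pCons a p) \<otimes> u = a \<odot> u \<oplus> h \<otimes> (ev h p \<otimes> u)"
    using assms by (simp add: ev_pCons l_distr m_assoc)
  also have "\<dots> = poly (pCons a p) l \<odot> u"
    using assms pCons by (simp add: smult_add_left mult.commute)
  finally show ?case .
qed (use assms in simp)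

text \<open>Put \<open>q = ev h Q\<close>. Since \<open>(h - l) q = 0\<close>, \<open>Q\<close> acts
  on \<open>q\<close>, and on \<open>k = star q * q\<close>, as the scalar
  \<open>m = poly Q l\<close>. Hence \<open>k * k\<close> is \<open>k\<close> scaled by the squared
  modulus of \<open>m\<close>, and dividing by that number gives a projection.\<close>

lemma eigenprojection:
  assumes h: "h \<in> carrier A" "star A h = h"
    and ev0: "ev h ([:- l, 1:] * Q) = \<zero>" and q0: "ev h Q \<noteq> \<zero>"
  defines "k \<equiv> star A (ev h Q) \<otimes> ev h Q"
  shows "\<exists>c. projection (c \<odot> k) \<and> c \<odot> k \<noteq> \<zero> \<and> h \<otimes> (c \<odot> k) = l \<odot> (c \<odot> k)"
proof -
  define q where "q = ev h Q"
  define m where "m = poly Q l"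
  have q: "q \<in> carrier A" and k: "k \<in> carrier A" and k_eq: "k = star A q \<otimes> q"
    using h by (auto simp: q_def k_def)
  have hq: "h \<otimes> q = l \<odot> q"
    using ev0[unfolded ev_linear_factor[OF h(1)]] h q by (simp add: q_def)
  have "star A (h \<otimes> q) = star A (q \<otimes> h)"
    using h ev_commute[of h Q] by (simp add: q_def)
  then have hsq: "h \<otimes> star A q = star A q \<otimes> h"
    using h q by (simp add: star_mult)
  have hk: "h \<otimes> k = l \<odot> k"
    using hsq hq h q by (metis k_eq m_assoc smult_mult_right star_closed)
  have star_k: "star A k = k"
    using q by (simp add: k_eq star_mult)
  have qk: "q \<otimes> k = m \<odot> k"
    using ev_eigenvector[OF h(1) k hk] by (simp add: q_def m_def)
  have "q \<otimes> q = m \<odot> q"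
    using ev_eigenvector[OF h(1) q hq] by (simp add: q_def m_def)
  then have "k \<otimes> q = m \<odot> k"
    using q by (simp add: k_eq m_assoc)
  then have "star A q \<otimes> k = cnj m \<odot> k"
    using q k star_k by (metis star_mult star_smult)
  then have kk: "k \<otimes> k = (cnj m * m) \<odot> k"
    using q k qk by (metis k_eq m_assoc mult.commute smult_mult_right smult_smult star_closed)
  have k0: "k \<noteq> \<zero>"
    using star_mult_eq_zero[OF q] q0 by (auto simp: k_eq q_def)
  \<comment> \<open>With \<open>m = 0\<close> the self-adjoint \<open>k\<close> would have square
    zero and so vanish.\<close>
  have m0: "m \<noteq> 0"
    using kk star_mult_eq_zero[OF k] k k0 star_k by auto
  define c where "c = 1 / (cnj m * m)"
  have c: "cnj c = c" "c * (cnj m * m) = 1" "c \<noteq> 0"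
    using m0 by (auto simp: c_def)
  have "projection (c \<odot> k)"
    unfolding projection_def using k kk star_k c by (simp add: star_smult mult.assoc)
  moreover have "c \<odot> k \<noteq> \<zero>"
    using c k k0 by (simp add: smult_eq_zero)
  ultimately show ?thesis
    using h k hk by (auto simp: mult.commute)
qed

text \<open>The degree is lowered by splitting off a root \<open>l\<close>:
  \<open>z = (h - l) y\<close> is annihilated by the cofactor, which is why \<open>y\<close> is
  arbitrary. The recursion \<open>h^(k+1) y = l h^k y + h^k z\<close> then carries the bound over,
  the gap between \<open>r\<close> and \<open>R\<close> absorbing the term with
  \<open>z\<close>.\<close>

lemma power_growth:
  assumes h: "h \<in> carrier A"
  shows "\<lbrakk>P \<noteq> 0; y \<in> carrier A; ev h P \<otimes> y = \<zero>; \<And>l. poly P l = 0 \<Longrightarrow> cmod l \<le> r; r < R; 0 \<le> r\<rbrakk> \<Longrightarrow>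
    \<exists>C\<ge>0. \<forall>k::nat. cnorm A (h [^] k \<otimes> y) \<le> C * R ^ k"
proof (induction "Polynomial.degree P" arbitrary: P y)
  case 0
  then obtain c where c: "P = [:c:]" "c \<noteq> 0"
    by (metis degree_eq_zeroE pCons_0_0)
  then have "y = \<zero>" using 0 h by (simp add: ev_pCons smult_eq_zero)
  then show ?case using h by (intro exI[of _ 0]) auto
next
  case (Suc n)
  then have "\<not> constant (poly P)" by (simp add: constant_degree)
  then obtain l where l: "poly P l = 0" using fundamental_theorem_of_algebra by blast
  then obtain Q where Q: "P = [:- l, 1:] * Q" by (metis dvdE poly_eq_0_iff_dvd)
  then have Q0: "Q \<noteq> 0" using Suc.prems by auto
  have deg: "n = Polynomial.degree Q"
    using Suc.hyps(2) Q0 unfolding Q by (subst (asm) degree_mult_eq) auto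
  define z where "z = h \<otimes> y \<ominus> l \<odot> y"
  have z: "z \<in> carrier A" using h Suc.prems by (simp add: z_def)
  have "ev h Q \<otimes> z = (h \<otimes> ev h Q \<ominus> l \<odot> ev h Q) \<otimes> y"
  proof -
    have "ev h Q \<otimes> z = (ev h Q \<otimes> h) \<otimes> y \<ominus> l \<odot> (ev h Q \<otimes> y)"
      using h Suc.prems by (simp add: z_def diff_smult' r_distr m_assoc)
    also have "\<dots> = (h \<otimes> ev h Q) \<otimes> y \<ominus> l \<odot> (ev h Q \<otimes> y)"
      using ev_commute[OF h] by simp
    also have "\<dots> = (h \<otimes> ev h Q \<ominus> l \<odot> ev h Q) \<otimes> y"
      using h Suc.prems by (simp add: diff_smult' l_distr)
    finally show ?thesis .
  qed
  then have "ev h Q \<otimes> z = \<zero>"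
    using Suc.prems(3) by (simp only: Q ev_linear_factor[OF h])
  moreover have "cmod m \<le> r" if "poly Q m = 0" for m
    using that Suc.prems(4)[of m] by (simp add: Q)
  ultimately obtain C where C: "C \<ge> 0" "\<And>k::nat. cnorm A (h [^] k \<otimes> z) \<le> C * R ^ k"
    using Suc.hyps(1)[OF deg Q0 z] Suc.prems(5,6) by blast
  \<comment> \<open>The first entry starts the induction at \<open>k = 0\<close>; the second ensures
    \<open>r * C' + C \<le> R * C'\<close>, which is the induction step.\<close>
  define C' where "C' = max (cnorm A y) (C / (R - r))"
  have C': "C' \<ge> 0" "C \<le> (R - r) * C'" "cnorm A y \<le> C'"
    using C(1) Suc.prems by (auto simp: C'_def max_def field_simps intro: order.trans)
  have "cnorm A (h [^] k \<otimes> y) \<le> C' * R ^ k" for k :: nat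
  proof (induction k)
    case (Suc k)
    let ?u = "h [^] k"
    have u: "?u \<in> carrier A" and y: "y \<in> carrier A" using h Suc.prems \<open>y \<in> carrier A\<close> by auto
    have "h [^] Suc k \<otimes> y = l \<odot> (?u \<otimes> y) \<oplus> ?u \<otimes> z"
    proof -
      have "h \<otimes> y = l \<odot> y \<oplus> z"
        unfolding z_def using h y smult_closed[OF y, of l] by algebra
      then have "?u \<otimes> (h \<otimes> y) = l \<odot> (?u \<otimes> y) \<oplus> ?u \<otimes> z"
        using h y u z by (simp add: r_distr)
      then show ?thesis using h y u by (simp add: m_assoc)
    qed
    then have "cnorm A (h [^] Suc k \<otimes> y) \<le> cmod l * cnorm A (?u \<otimes> y) + cnorm A (?u \<otimes> z)"
      using u y z cnorm_triangle[of "l \<odot> (?u \<otimes> y)" "?u \<otimes> z"] by (simp add: cnorm_smult)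
    also have "\<dots> \<le> r * (C' * R ^ k) + C * R ^ k"
      using Suc.IH C(2)[of k] Suc.prems \<open>poly P l = 0\<close> \<open>\<And>l. poly P l = 0 \<Longrightarrow> cmod l \<le> r\<close> \<open>0 \<le> r\<close> u y
      by (intro add_mono mult_mono) auto
    also have "\<dots> = (r * C' + C) * R ^ k" by (simp add: algebra_simps)
    also have "\<dots> \<le> (R * C') * R ^ k"
      using C' \<open>0 \<le> r\<close> \<open>r < R\<close> by (intro mult_right_mono) (auto simp: algebra_simps)
    finally show ?case by (simp add: algebra_simps)
  qed (use C' \<open>y \<in> carrier A\<close> in simp)
  with C'(1) show ?case by blast
qed

text \<open>For \<open>R > r\<close> the powers of \<open>h\<close> are at most
  \<open>C * R ^ k\<close> in norm, while along \<open>k = 2 ^ n\<close> their norms are exactly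
  \<open>cnorm A h ^ k\<close>. A norm above \<open>R\<close> would make the quotient of the two
  unbounded.\<close>

lemma cnorm_le_spectral_bound:
  assumes h: "h \<in> carrier A" "star A h = h" and P: "P \<noteq> 0" "ev h P = \<zero>"
    and r: "\<And>l. poly P l = 0 \<Longrightarrow> cmod l \<le> r" "0 \<le> r"
  shows "cnorm A h \<le> r"
proof (rule dense_ge)
  fix R assume "r < R"
  then obtain C where C: "C \<ge> 0" "\<And>k::nat. cnorm A (h [^] k \<otimes> \<one>) \<le> C * R ^ k"
    using power_growth[OF h(1) P(1) one_closed _ r(1) _ r(2), of R] P h by auto
  show "cnorm A h \<le> R"
  proof (rule ccontr)
    assume "\<not> cnorm A h \<le> R"
    moreover have R: "R > 0" using r \<open>r < R\<close> by simp
    ultimately have "1 < cnorm A h / R" by simp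
    \<comment> \<open>The norm is known exactly only at exponents \<open>2 ^ n\<close>; the ratio
      exceeds 1 and \<open>n \<le> 2 ^ n\<close>, so passing to that exponent preserves the
      inequality.\<close>
    then obtain n where n: "C < (cnorm A h / R) ^ n" using real_arch_pow by blast
    also have "\<dots> \<le> (cnorm A h / R) ^ (2 ^ n)"
      using \<open>1 < cnorm A h / R\<close> by (intro power_increasing) (auto intro: less_imp_le)
    also have "\<dots> \<le> C"
      using C(2)[of "2 ^ n"] cnorm_self_adjoint_power[OF h, of n] h R
      by (simp add: power_divide pos_divide_le_eq)
    finally show False by simp
  qed
qed

section \<open>Finite-dimensional subalgebras: linear dependence and eigenprojections\<close>

lemma subalgebraD:
  assumes "cstar_subalgebra S A"
  shows "S \<subseteq> carrier A" "\<zero> \<in> S" "\<one> \<in> S"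
    and "\<And>a. a \<in> S \<Longrightarrow> a \<in> carrier A"
    and "\<And>a. a \<in> S \<Longrightarrow> star A a \<in> S"
    and "\<And>a c. a \<in> S \<Longrightarrow> c \<odot> a \<in> S"
    and "\<And>a b. a \<in> S \<Longrightarrow> b \<in> S \<Longrightarrow> a \<oplus> b \<in> S"
    and "\<And>a b. a \<in> S \<Longrightarrow> b \<in> S \<Longrightarrow> a \<otimes> b \<in> S"
    and "\<And>a b. a \<in> S \<Longrightarrow> b \<in> S \<Longrightarrow> a \<ominus> b \<in> S"
proof -
  have S: "subring S A" using assms by (simp add: cstar_subalgebra_def)
  note E = subringE[OF S]
  show "S \<subseteq> carrier A" "\<zero> \<in> S" "\<one> \<in> S" using E by auto
  show "\<And>a. a \<in> S \<Longrightarrow> a \<in> carrier A" using E by auto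
  show "\<And>a. a \<in> S \<Longrightarrow> star A a \<in> S" "\<And>a c. a \<in> S \<Longrightarrow> c \<odot> a \<in> S"
    using assms by (auto simp: cstar_subalgebra_def)
  show "\<And>a b. a \<in> S \<Longrightarrow> b \<in> S \<Longrightarrow> a \<oplus> b \<in> S" "\<And>a b. a \<in> S \<Longrightarrow> b \<in> S \<Longrightarrow> a \<otimes> b \<in> S"
    "\<And>a b. a \<in> S \<Longrightarrow> b \<in> S \<Longrightarrow> a \<ominus> b \<in> S"
    using E by (auto simp: minus_eq)
qed

text \<open>Expanding the first \<open>card F + 1\<close> terms in the spanning set \<open>F\<close>
  gives a homogeneous system with more unknowns than equations. Indexing by position rather than by
  element lets repeated terms count as dependent.\<close>

lemma finite_dim_dependent:
  assumes S: "finite_dim S A" "S \<subseteq> carrier A" and v: "\<And>i::nat. v i \<in> S"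
  shows "\<exists>n d. (\<exists>i\<le>n. d i \<noteq> 0) \<and> (\<Oplus>i\<in>{..n}. d i \<odot> v i) = \<zero>"
proof -
  obtain F where F: "finite F" "F \<subseteq> S" "\<And>a. a \<in> S \<Longrightarrow> \<exists>c. a = (\<Oplus>x\<in>F. c x \<odot> x)"
    using S(1) unfolding finite_dim_def by blast
  have "\<forall>i. \<exists>c. v i = (\<Oplus>x\<in>F. c x \<odot> x)" using F(3) v by blast
  then obtain c where c: "\<And>i. v i = (\<Oplus>x\<in>F. c i x \<odot> x)" by metis
  have F_carrier: "F \<subseteq> carrier A" using F S by blast
  have scale: "d \<odot> (\<Oplus>x\<in>F. g x \<odot> x) = (\<Oplus>x\<in>F. (d * g x) \<odot> x)" for d g
  proof -
    have "d \<odot> (\<Oplus>x\<in>F. g x \<odot> x) = (\<Oplus>x\<in>F. d \<odot> (g x \<odot> x))"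
      using F F_carrier by (intro module.finsum_smult_ldistr[OF module_A])
        (auto simp: ring_of_type_algebra_def)
    also have "\<dots> = (\<Oplus>x\<in>F. (d * g x) \<odot> x)"
      using F_carrier by (intro finsum_cong') auto
    finally show ?thesis .
  qed
  have lin: "(\<Oplus>i\<in>{..n}. d i \<odot> v i) = (\<Oplus>x\<in>F. (\<Sum>i\<le>n. d i * c i x) \<odot> x)" for n d
  proof (induction n)
    case 0
    have "(\<Oplus>i\<in>{..0}. d i \<odot> v i) = d 0 \<odot> v 0"
      using v S by (intro finsum_0) auto
    also have "\<dots> = (\<Oplus>x\<in>F. (d 0 * c 0 x) \<odot> x)"
      by (simp only: c scale)
    finally show ?case by simp
  next
    case (Suc n)
    have "(\<Oplus>i\<in>{..Suc n}. d i \<odot> v i) = d (Suc n) \<odot> v (Suc n) \<oplus> (\<Oplus>i\<in>{..n}. d i \<odot> v i)"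
      using v S by (intro finsum_Suc) auto
    also have "\<dots> = (\<Oplus>x\<in>F. (d (Suc n) * c (Suc n) x) \<odot> x) \<oplus> (\<Oplus>x\<in>F. (\<Sum>i\<le>n. d i * c i x) \<odot> x)"
      by (simp only: Suc) (simp only: c scale)
    also have "\<dots> = (\<Oplus>x\<in>F. (d (Suc n) * c (Suc n) x) \<odot> x \<oplus> (\<Sum>i\<le>n. d i * c i x) \<odot> x)"
      using F_carrier by (intro finsum_addf[symmetric]) auto
    also have "\<dots> = (\<Oplus>x\<in>F. (\<Sum>i\<le>Suc n. d i * c i x) \<odot> x)"
      using F_carrier by (intro finsum_cong') (auto simp: smult_add_left[symmetric] add.commute)
    finally show ?case .
  qed
  obtain d where d: "\<exists>i\<in>{..card F}. d i \<noteq> 0" "\<forall>x\<in>F. (\<Sum>i\<le>card F. d i * c i x) = 0"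
    using homogeneous_system_nontrivial_solution[OF F(1), of "{..card F}" c] by auto
  have "(\<Oplus>x\<in>F. (\<Sum>i\<le>card F. d i * c i x) \<odot> x) = (\<Oplus>x\<in>F. \<zero>)"
    using d(2) F_carrier by (intro finsum_cong') auto
  then show ?thesis using d(1) lin by (metis atMost_iff finsum_zero)
qed

lemma annihilating_polynomial:
  assumes S: "finite_dim S A" "cstar_subalgebra S A" and h: "h \<in> S"
  shows "\<exists>P. P \<noteq> 0 \<and> ev h P = \<zero>"
proof -
  note sub = subalgebraD[OF S(2)]
  have "h [^] i \<in> S" for i :: nat using h sub by (induction i) auto
  then obtain n :: nat and d where d: "\<exists>i\<le>n. d i \<noteq> 0" "(\<Oplus>i\<in>{..n}. d i \<odot> h [^] i) = \<zero>"
    using finite_dim_dependent[OF S(1) sub(1), of "\<lambda>i. h [^] i"] by blast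
  then obtain j where j: "j \<le> n" "d j \<noteq> 0" by blast
  let ?P = "\<Sum>i\<le>n. Polynomial.monom (d i) i"
  have "Polynomial.coeff ?P j = d j" using j by (simp add: coeff_sum coeff_monom)
  then have "?P \<noteq> 0" using j by force
  then show ?thesis using d(2) ev_sum_monom[of h d n] sub h by auto
qed

text \<open>An annihilating \<open>P\<close> of least degree serves as minimal polynomial, and
  \<open>l\<close> is a root of largest modulus. The spectral bound gives the norm estimate;
  minimality keeps the cofactor \<open>Q\<close> from annihilating \<open>h\<close>, which is what
  \<open>eigenprojection\<close> requires.\<close>

lemma norm_eigenprojection:
  assumes S: "finite_dim S A" "cstar_subalgebra S A" and h: "h \<in> S" "star A h = h"
  shows "\<exists>l e. e \<in> S \<and> projection e \<and> e \<noteq> \<zero> \<and> h \<otimes> e = l \<odot> e \<and> cnorm A h \<le> cmod l"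
proof -
  note sub = subalgebraD[OF S(2)]
  have hA: "h \<in> carrier A" using h sub by blast
  define P where "P = arg_min Polynomial.degree (\<lambda>P. P \<noteq> 0 \<and> ev h P = \<zero>)"
  have P: "P \<noteq> 0" "ev h P = \<zero>" "\<And>Q. Q \<noteq> 0 \<Longrightarrow> ev h Q = \<zero> \<Longrightarrow> Polynomial.degree P \<le> Polynomial.degree Q"
    using arg_min_nat_lemma[of "\<lambda>P. P \<noteq> 0 \<and> ev h P = \<zero>" _ Polynomial.degree] annihilating_polynomial[OF S h(1)]
    unfolding P_def by blast+
  let ?R = "{l. poly P l = 0}"
  have "Polynomial.degree P \<noteq> 0"
  proof
    assume "Polynomial.degree P = 0"
    then obtain c where c: "P = [:c:]" "c \<noteq> 0" using P(1) by (metis degree_eq_zeroE pCons_0_0)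
    then show False using P(2) hA by (simp add: ev_pCons smult_eq_zero)
  qed
  then have "?R \<noteq> {}"
    using fundamental_theorem_of_algebra[of P] by (auto simp: constant_degree)
  moreover have fin: "finite ?R" using poly_roots_finite[OF P(1)] .
  ultimately have "Max (cmod ` ?R) \<in> cmod ` ?R" by (intro Max_in) auto
  then obtain l where l: "poly P l = 0" "cmod l = Max (cmod ` ?R)" by auto
  have "cmod m \<le> cmod l" if "poly P m = 0" for m
    using fin that unfolding l(2) by (intro Max_ge) auto
  then have "cnorm A h \<le> cmod l"
    by (intro cnorm_le_spectral_bound[OF hA h(2) P(1,2)]) auto
  moreover from l obtain Q where Q: "P = [:- l, 1:] * Q" by (metis dvdE poly_eq_0_iff_dvd)
  then have Q0: "Q \<noteq> 0" using P(1) by auto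
  have "Polynomial.degree P = Suc (Polynomial.degree Q)"
    using Q0 unfolding Q by (subst degree_mult_eq) auto
  then have q0: "ev h Q \<noteq> \<zero>" using P(3)[OF Q0] by auto
  let ?k = "star A (ev h Q) \<otimes> ev h Q"
  obtain c where c: "projection (c \<odot> ?k)" "c \<odot> ?k \<noteq> \<zero>" "h \<otimes> (c \<odot> ?k) = l \<odot> (c \<odot> ?k)"
    using eigenprojection[OF hA h(2) _ q0, of l] P(2) Q by auto
  \<comment> \<open>The projection is built from \<open>h\<close> by a polynomial, star, product and
    scaling, so it stays in \<open>S\<close>.\<close>
  have "ev h R \<in> S" for R
    using sub h hA by (induction R) (auto simp: ev_pCons)
  then have "c \<odot> ?k \<in> S" using sub by auto
  ultimately show ?thesis using c by blast
qed

subsection \<open>Minimal projections\<close>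

text \<open>Minimality is encoded by scalar compressions rather than by the order of projections,
  because these scalars carry all later positivity arguments and define the state.\<close>

definition minimal_projection :: "'a set \<Rightarrow> 'a \<Rightarrow> bool" where
  "minimal_projection S e \<longleftrightarrow>
     e \<in> S \<and> projection e \<and> e \<noteq> \<zero> \<and> (\<forall>y\<in>S. \<exists>c. e \<otimes> y \<otimes> e = c \<odot> e)"

lemma projection_mult_commute:
  assumes "projection e" "projection f" "e \<otimes> f = f"
  shows "f \<otimes> e = f"
  using assms star_mult[of e f] by (simp add: projection_def)

text \<open>A strictly decreasing sequence of projections is linearly independent, since multiplying by
  \<open>s k - s (k + 1)\<close> singles out the \<open>k\<close>-th coefficient.\<close>

lemma smallest_projection_below:
  assumes S: "finite_dim S A" "cstar_subalgebra S A"
    and p: "p \<in> S" "projection p" "p \<noteq> \<zero>"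
  defines "Q \<equiv> \<lambda>e. e \<in> S \<and> projection e \<and> e \<noteq> \<zero> \<and> p \<otimes> e = e"
  shows "\<exists>e. Q e \<and> (\<forall>f. Q f \<and> e \<otimes> f = f \<longrightarrow> f = e)"
proof (rule ccontr)
  note sub = subalgebraD[OF S(2)]
  assume "\<not> ?thesis"
  then have step: "\<exists>f. Q f \<and> (e \<otimes> f = f \<and> f \<noteq> e)" if "Q e" for e
    using that by blast
  have "Q p" using p by (auto simp: Q_def projection_def)
  then have "\<exists>s. \<forall>n. Q (s n) \<and> (s n \<otimes> s (Suc n) = s (Suc n) \<and> s (Suc n) \<noteq> s n)"
    using step by (intro dependent_nat_choice) auto
  then obtain s where s: "\<And>n. Q (s n)" "\<And>n. s n \<otimes> s (Suc n) = s (Suc n)"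
    "\<And>n. s (Suc n) \<noteq> s n" by blast
  have sA: "s n \<in> carrier A" "s n \<in> S" "projection (s n)" for n
    using s(1)[of n] sub by (auto simp: Q_def)
  have decr: "s i \<otimes> s j = s j" if "i \<le> j" for i j
    using that
  proof (induction j rule: dec_induct)
    case base
    show ?case using sA[of i] by (simp add: projection_def)
  next
    case (step j)
    then show ?case using s(2)[of j] sA by (metis m_assoc)
  qed
  then have decr': "s j \<otimes> s i = s j" if "i \<le> j" for i j
    using that sA projection_mult_commute by blast
  obtain n d where d: "\<exists>i\<le>n. d i \<noteq> 0" "(\<Oplus>i\<in>{..n}. d i \<odot> s i) = \<zero>"
    using finite_dim_dependent[OF S(1) sub(1), of s] sA by blast
  \<comment> \<open>For every \<open>i \<le> k\<close> the product of \<open>s i\<close> with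
    \<open>g\<close> below is \<open>g\<close>, so \<open>g\<close> kills only the later terms. The
    earlier ones vanish because \<open>k\<close> is the first index with a nonzero
    coefficient.\<close>
  define k where "k = (LEAST i. d i \<noteq> 0)"
  obtain j where j: "j \<le> n" "d j \<noteq> 0" using d(1) by blast
  have k: "d k \<noteq> 0" "k \<le> n"
    using LeastI[of "\<lambda>i. d i \<noteq> 0", OF j(2)] Least_le[of "\<lambda>i. d i \<noteq> 0", OF j(2)] j(1)
    by (auto simp: k_def)
  have k_least: "\<And>i. i < k \<Longrightarrow> d i = 0"
    unfolding k_def using not_less_Least by blast
  define g where "g = s k \<ominus> s (Suc k)"
  have g: "g \<in> carrier A" "g \<noteq> \<zero>"
    using sA s(3)[of k] by (auto simp: g_def)
  have coeff: "d i \<odot> s i \<otimes> g = (if k = i then d i \<odot> g else \<zero>)" for i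
  proof (cases i k rule: linorder_cases)
    case less
    then show ?thesis using k_least[of i] sA g by simp
  next
    case equal
    have "s k \<otimes> g = g"
      using sA decr[of k k] decr[of k "Suc k"] unfolding g_def
      by (simp add: diff_smult r_distr)
    then show ?thesis using equal sA g by simp
  next
    case greater
    then have "s i \<otimes> s k = s i" "s i \<otimes> s (Suc k) = s i" using decr' by auto
    moreover have "s i \<otimes> g = s i \<otimes> s k \<ominus> s i \<otimes> s (Suc k)"
      using sA unfolding g_def by (simp add: diff_smult r_distr)
    ultimately have "s i \<otimes> g = \<zero>" using sA by simp
    then show ?thesis using greater sA g by simp
  qed
  have "\<zero> = (\<Oplus>i\<in>{..n}. d i \<odot> s i) \<otimes> g" using d g by simp
  also have "\<dots> = (\<Oplus>i\<in>{..n}. d i \<odot> s i \<otimes> g)"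
    using sA g by (intro finsum_ldistr) auto
  also have "\<dots> = (\<Oplus>i\<in>{..n}. if k = i then d i \<odot> g else \<zero>)"
    by (simp only: coeff)
  also have "\<dots> = d k \<odot> g"
    using k g by (intro finsum_singleton) auto
  finally have "d k \<odot> g = \<zero>" by (rule sym)
  then show False using k g by (simp add: smult_eq_zero)
qed

text \<open>Let \<open>e\<close> be smallest below \<open>p\<close>. For self-adjoint
  \<open>y\<close>, the compression \<open>x = e y e\<close> has an eigenprojection \<open>f\<close>
  for an eigenvalue \<open>l\<close> dominating its norm. If \<open>l = 0\<close> then
  \<open>x = 0\<close>; otherwise \<open>f = (1 / l) x f\<close> lies below \<open>e\<close>, so
  \<open>f = e\<close> and \<open>x = l e\<close>. Real and imaginary parts give the general
  case.\<close>

lemma minimal_projection_below: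
  assumes S: "finite_dim S A" "cstar_subalgebra S A"
    and p: "p \<in> S" "projection p" "p \<noteq> \<zero>"
  shows "\<exists>e. minimal_projection S e \<and> p \<otimes> e = e"
proof -
  note sub = subalgebraD[OF S(2)]
  obtain e where e: "e \<in> S" "projection e" "e \<noteq> \<zero>" "p \<otimes> e = e"
    and least: "\<And>f. f \<in> S \<Longrightarrow> projection f \<Longrightarrow> f \<noteq> \<zero> \<Longrightarrow> p \<otimes> f = f \<Longrightarrow> e \<otimes> f = f \<Longrightarrow> f = e"
    using smallest_projection_below[OF S p] by blast
  have eA: "e \<in> carrier A" "e \<otimes> e = e" "star A e = e" using e by (auto simp: projection_def)
  have pA: "p \<in> carrier A" using p sub by blast
  have self_adjoint: "\<exists>c. e \<otimes> y \<otimes> e = c \<odot> e" if y: "y \<in> S" "star A y = y" for y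
  proof -
    define x where "x = e \<otimes> y \<otimes> e"
    have yA: "y \<in> carrier A" using y sub by blast
    have x: "x \<in> S" "x \<in> carrier A" "star A x = x" "e \<otimes> x = x" "x \<otimes> e = x"
      using y e eA sub yA unfolding x_def
      by (auto simp: star_mult m_assoc) (auto simp flip: m_assoc simp: eA)
    obtain l f where f: "f \<in> S" "projection f" "f \<noteq> \<zero>" "x \<otimes> f = l \<odot> f" "cnorm A x \<le> cmod l"
      using norm_eigenprojection[OF S x(1,3)] by blast
    have fA: "f \<in> carrier A" using f by (simp add: projection_def)
    show ?thesis
    proof (cases "l = 0")
      case True
      then have "x = \<zero>" using f x cnorm_nonneg[of x] by (metis cnorm_eq_zero norm_zero order_antisym)
      then show ?thesis using eA by (intro exI[of _ 0]) (simp add: x_def)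
    next
      case False
      have f_eq: "f = (1 / l) \<odot> (x \<otimes> f)" using f(4) fA False by simp
      then have "e \<otimes> f = f"
        using x eA fA by (metis m_assoc m_closed smult_mult_right)
      moreover from this have "p \<otimes> f = f"
        using e(4) eA fA pA by (metis m_assoc)
      ultimately have "f = e" using least f by blast
      then have "x = l \<odot> e" using f(4) x by simp
      then show ?thesis by (auto simp: x_def)
    qed
  qed
  have "\<exists>c. e \<otimes> y \<otimes> e = c \<odot> e" if y: "y \<in> S" for y
  proof -
    have yA: "y \<in> carrier A" using y sub by blast
    define a where "a = (1 / 2) \<odot> (y \<oplus> star A y)"
    define b where "b = (- \<i> / 2) \<odot> (y \<oplus> (-1) \<odot> star A y)"
    have ab: "a \<in> S" "b \<in> S" "a \<in> carrier A" "b \<in> carrier A" using y sub yA by (auto simp: a_def b_def)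
    have "star A a = a" using yA by (simp add: a_def star_smult star_add a_comm)
    moreover have "star A b = b"
      using yA by (simp add: b_def star_smult star_add smult_add_right a_comm)
    ultimately obtain c c' where c: "e \<otimes> a \<otimes> e = c \<odot> e" "e \<otimes> b \<otimes> e = c' \<odot> e"
      using self_adjoint ab by blast
    have "a \<oplus> \<i> \<odot> b = ((1/2) \<odot> y \<oplus> (1/2) \<odot> star A y) \<oplus> ((1/2) \<odot> y \<oplus> (-1/2) \<odot> star A y)"
      using yA by (simp add: a_def b_def smult_add_right)
    also have "\<dots> = ((1/2) \<odot> y \<oplus> (1/2) \<odot> y) \<oplus> ((1/2) \<odot> star A y \<oplus> (-1/2) \<odot> star A y)"
      using yA by (simp add: a_ac)
    also have "\<dots> = y" using yA by (simp flip: smult_add_left)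
    finally have "e \<otimes> y \<otimes> e = e \<otimes> (a \<oplus> \<i> \<odot> b) \<otimes> e" by simp
    also have "\<dots> = e \<otimes> a \<otimes> e \<oplus> \<i> \<odot> (e \<otimes> b \<otimes> e)"
      using ab eA by (simp add: r_distr l_distr)
    also have "\<dots> = (c + \<i> * c') \<odot> e" using c eA by (simp add: smult_add_left)
    finally show ?thesis by blast
  qed
  then show ?thesis using e unfolding minimal_projection_def by blast
qed

text \<open>If the compression of \<open>star a * a\<close> by a minimal projection \<open>p\<close> were a negative multiple of
  \<open>p\<close>, then some \<open>z = \<alpha> p + a p\<close> would satisfy \<open>star z * z = 0\<close>, which forces \<open>a p = - \<alpha> p\<close>.\<close>

lemma minimal_projection_positive:
  assumes S: "cstar_subalgebra S A" and p: "minimal_projection S p" and a: "a \<in> S"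
    and l: "p \<otimes> (star A a \<otimes> a) \<otimes> p = l \<odot> p"
  shows "l \<in> \<real>\<^sub>\<ge>\<^sub>0"
proof -
  note sub = subalgebraD[OF S]
  have pA: "p \<in> carrier A" "p \<otimes> p = p" "star A p = p" "p \<noteq> \<zero>"
    using p by (auto simp: minimal_projection_def projection_def)
  have aA: "a \<in> carrier A" using a sub by blast
  define b where "b = a \<otimes> p"
  have b: "b \<in> carrier A" using aA pA by (simp add: b_def)
  have bb: "star A b \<otimes> b = l \<odot> p"
    using l aA pA by (simp add: b_def star_mult m_assoc)
  obtain c where "p \<otimes> a \<otimes> p = c \<odot> p"
    using p a by (auto simp: minimal_projection_def)
  then have pb: "p \<otimes> b = c \<odot> p" using aA pA by (simp add: b_def m_assoc)
  then have bp: "star A b \<otimes> p = cnj c \<odot> p"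
    using b pA by (metis star_mult star_smult)
  have "star A (l \<odot> p) = l \<odot> p"
    using b by (simp add: star_mult flip: bb)
  then have "cnj l = l" using pA by (simp add: star_smult smult_cancel)
  then obtain t where t: "l = of_real t" by (metis Reals_cnj_iff Reals_cases)
  have "t \<ge> 0"
  proof (rule ccontr)
    assume neg: "\<not> t \<ge> 0"
    define w where "w = sqrt ((cmod c)\<^sup>2 - t)"
    have "0 \<le> (cmod c)\<^sup>2" by simp
    then have "0 \<le> (cmod c)\<^sup>2 - t" using neg by linarith
    then have w: "w\<^sup>2 = (cmod c)\<^sup>2 - t" by (simp add: w_def)
    \<comment> \<open>Completing the square: \<open>star A z \<otimes> z\<close> is
      \<open>|al + c|^2 - |c|^2 + t\<close> times \<open>p\<close>, so \<open>al + c = w\<close>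
      makes it vanish.\<close>
    define al where "al = of_real w - c"
    define z where "z = al \<odot> p \<oplus> b"
    have zA: "z \<in> carrier A" using pA b by (simp add: z_def)
    have "star A z \<otimes> z = (cnj al \<odot> p \<oplus> star A b) \<otimes> (al \<odot> p \<oplus> b)"
      using pA b by (simp add: z_def star_add star_smult)
    also have "\<dots> = ((cnj al * al) \<odot> p \<oplus> (cnj al * c) \<odot> p) \<oplus> ((al * cnj c) \<odot> p \<oplus> l \<odot> p)"
      using pA b pb bp bb by (simp add: r_distr l_distr smult_add_right a_ac mult.commute)
    also have "\<dots> = (cnj al * al + cnj al * c + (al * cnj c + l)) \<odot> p"
      using pA by (simp add: smult_add_left)
    also have "cnj al * al + cnj al * c + (al * cnj c + l) = of_real (w\<^sup>2) - c * cnj c + of_real t"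
      by (simp add: al_def t algebra_simps power2_eq_square)
    also have "\<dots> = 0" by (simp add: w flip: complex_norm_square)
    finally have "star A z \<otimes> z = \<zero>" using pA by simp
    then have "z = \<zero>" using star_mult_eq_zero zA by blast
    then have "\<ominus> b = al \<odot> p"
      using pA b minus_equality[of "al \<odot> p" b] by (simp add: z_def)
    then have "b = \<ominus> (al \<odot> p)" using b by (metis minus_minus)
    then have "b = (- al) \<odot> p" using pA by (simp add: uminus_smult)
    \<comment> \<open>For a multiple of \<open>p\<close> the coefficient of
      \<open>star A b \<otimes> b\<close> is a squared modulus, which contradicts
      \<open>t < 0\<close>.\<close>
    then have "star A b \<otimes> b = (cnj al * al) \<odot> p"
      using pA by (simp add: star_smult mult.commute)
    then have "of_real t = cnj al * al" using bb t pA by (simp add: smult_cancel)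
    then have "of_real t = (of_real ((cmod al)\<^sup>2) :: complex)"
      by (metis complex_norm_square mult.commute)
    then show False using neg by (metis of_real_eq_iff zero_le_power2)
  qed
  then show ?thesis by (simp add: t)
qed

text \<open>This is monotonicity of the norm on positive elements, obtained without an order. A
  minimal \<open>f\<close> below a norm-dominating eigenprojection of \<open>h = star x * x\<close>
  compresses \<open>h\<close> and \<open>g = star d * d\<close> to numbers
  \<open>l, m \<ge> 0\<close>. Compression does not increase norms, so the norm of
  \<open>h + g\<close> is at least \<open>l + m \<ge> l\<close>.\<close>

lemma finite_dim_cnorm_sum_squares:
  assumes S: "finite_dim S A" "cstar_subalgebra S A" and x: "x \<in> S" and d: "d \<in> S"
  shows "(cnorm A x)\<^sup>2 \<le> cnorm A (star A x \<otimes> x \<oplus> star A d \<otimes> d)"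
proof -
  note sub = subalgebraD[OF S(2)]
  have A: "x \<in> carrier A" "d \<in> carrier A" using x d sub by auto
  define h where "h = star A x \<otimes> x"
  define g where "g = star A d \<otimes> d"
  have hg: "h \<in> S" "h \<in> carrier A" "g \<in> S" "g \<in> carrier A" "star A h = h"
    using x d A sub by (auto simp: h_def g_def star_mult)
  obtain l e where e: "e \<in> S" "projection e" "e \<noteq> \<zero>" "h \<otimes> e = l \<odot> e" "cnorm A h \<le> cmod l"
    using norm_eigenprojection[OF S hg(1,5)] by blast
  obtain f where f: "minimal_projection S f" "e \<otimes> f = f"
    using minimal_projection_below[OF S e(1-3)] by blast
  have fA: "f \<in> carrier A" "f \<otimes> f = f" "cnorm A f = 1" and eA: "e \<in> carrier A"
    using f e cnorm_projection[of f] by (auto simp: minimal_projection_def projection_def)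
  have "h \<otimes> f = l \<odot> f"
    using e(4) f(2) fA eA hg by (metis m_assoc smult_mult_left)
  then have fh: "f \<otimes> h \<otimes> f = l \<odot> f" using fA hg by (simp add: m_assoc)
  obtain m where fg: "f \<otimes> g \<otimes> f = m \<odot> f"
    using f(1) hg by (auto simp: minimal_projection_def)
  have "l \<in> \<real>\<^sub>\<ge>\<^sub>0" "m \<in> \<real>\<^sub>\<ge>\<^sub>0"
    using minimal_projection_positive[OF S(2) f(1)] x d fh fg by (auto simp: h_def g_def)
  then have "cmod l \<le> cmod (l + m)"
    by (auto simp: nonneg_Reals_def simp flip: of_real_add)
  also have "\<dots> = cnorm A (f \<otimes> (h \<oplus> g) \<otimes> f)"
    using fA hg fh fg by (simp add: r_distr l_distr cnorm_smult flip: smult_add_left)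
  also have "\<dots> \<le> cnorm A (f \<otimes> (h \<oplus> g)) * cnorm A f"
    using fA hg by (intro cnorm_mult) auto
  also have "\<dots> \<le> cnorm A (h \<oplus> g)"
    using cnorm_mult[of f "h \<oplus> g"] fA hg by simp
  finally show ?thesis
    using e(5) cstar_identity[OF A(1)] by (simp add: h_def g_def)
qed

subsection \<open>Limits\<close>

lemma Metric_space_cdist: "Metric_space (carrier A) (cdist A)"
proof
  show "0 \<le> cdist A x y" for x y by (simp add: cdist_def)
  show "cdist A x y = cdist A y x" for x y by (simp add: cdist_def cnorm_diff_commute)
  show "cdist A x y = 0 \<longleftrightarrow> x = y" if "x \<in> carrier A" "y \<in> carrier A" for x y
    using that by (simp add: cdist_def)
  show "cdist A x z \<le> cdist A x y + cdist A y z"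
    if "x \<in> carrier A" "y \<in> carrier A" "z \<in> carrier A" for x y z
    using that by (simp add: cdist_def cnorm_diff_triangle)
qed

text \<open>Convergence is phrased through a real sequence so that the limit rules for reals apply;
  \<open>cauchy_conv\<close> and \<open>af_dense\<close> translate from the abstract metric
  space.\<close>

definition conv :: "(nat \<Rightarrow> 'a) \<Rightarrow> 'a \<Rightarrow> bool" where
  "conv s l \<longleftrightarrow> range s \<subseteq> carrier A \<and> l \<in> carrier A \<and> (\<lambda>k. cnorm A (s k \<ominus> l)) \<longlonglongrightarrow> 0"

lemma convD:
  assumes "conv s l"
  shows "s k \<in> carrier A" "l \<in> carrier A" "(\<lambda>k. cnorm A (s k \<ominus> l)) \<longlonglongrightarrow> 0"
  using assms by (auto simp: conv_def)

lemma convI: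
  assumes "\<And>k. s k \<in> carrier A" "l \<in> carrier A"
    and "\<And>k. cnorm A (s k \<ominus> l) \<le> f k" "f \<longlonglongrightarrow> 0"
  shows "conv s l"
  unfolding conv_def
  using assms tendsto_sandwich[of "\<lambda>_. 0" "\<lambda>k. cnorm A (s k \<ominus> l)" sequentially f 0] by auto

lemma cauchy_conv:
  assumes s: "\<And>k. s k \<in> carrier A"
    and cauchy: "\<And>\<epsilon>. \<epsilon> > 0 \<Longrightarrow> \<exists>N. \<forall>m\<ge>N. \<forall>n\<ge>N. cnorm A (s m \<ominus> s n) < \<epsilon>"
  shows "\<exists>l. conv s l"
proof -
  interpret M: Metric_space "carrier A" "cdist A" by (rule Metric_space_cdist)
  have "M.MCauchy s"
    unfolding M.MCauchy_def using s cauchy by (auto simp: cdist_def)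
  then obtain l where "limitin M.mtopology s l sequentially"
    using mcomplete_A by (auto simp: M.mcomplete_def)
  then have "conv s l"
    using s by (auto simp: M.limitin_metric_dist_null conv_def cdist_def)
  then show ?thesis by blast
qed

lemma conv_cnorm:
  assumes "conv s l"
  shows "(\<lambda>k. cnorm A (s k)) \<longlonglongrightarrow> cnorm A l"
proof -
  have "(\<lambda>k. \<bar>cnorm A (s k) - cnorm A l\<bar>) \<longlonglongrightarrow> 0"
    using convD[OF assms] abs_cnorm_diff_le
    by (intro tendsto_sandwich[OF _ _ tendsto_const convD(3)[OF assms]]) auto
  then show ?thesis by (simp add: LIM_zero_iff tendsto_rabs_zero_iff)
qed

lemma conv_const: "a \<in> carrier A \<Longrightarrow> conv (\<lambda>_. a) a"
  by (auto simp: conv_def)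

lemma conv_unique:
  assumes "conv s l" "conv s m"
  shows "l = m"
proof -
  note C = convD[OF assms(1)] convD[OF assms(2)]
  have "(\<lambda>k. cnorm A (l \<ominus> m)) \<longlonglongrightarrow> 0"
  proof (rule tendsto_sandwich[OF _ _ tendsto_const])
    show "(\<lambda>k. cnorm A (s k \<ominus> l) + cnorm A (s k \<ominus> m)) \<longlonglongrightarrow> 0"
      using tendsto_add[OF C(3,6)] by simp
    show "\<forall>\<^sub>F k in sequentially. cnorm A (l \<ominus> m) \<le> cnorm A (s k \<ominus> l) + cnorm A (s k \<ominus> m)"
      using C cnorm_diff_triangle[of l _ m] by (auto simp: cnorm_diff_commute[of l])
  qed (use C in auto)
  then have "cnorm A (l \<ominus> m) = 0" by (simp add: LIMSEQ_const_iff)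
  then show ?thesis using C by simp
qed

lemma conv_Suc: "conv s l \<Longrightarrow> conv (\<lambda>k. s (Suc k)) l"
  unfolding conv_def using LIMSEQ_Suc[of "\<lambda>k. cnorm A (s k \<ominus> l)" 0] by auto

lemma conv_add:
  assumes "conv s l" "conv t m"
  shows "conv (\<lambda>k. s k \<oplus> t k) (l \<oplus> m)"
proof -
  note C = convD[OF assms(1)] convD[OF assms(2)]
  show ?thesis
  proof (rule convI)
    show "cnorm A (s k \<oplus> t k \<ominus> (l \<oplus> m)) \<le> cnorm A (s k \<ominus> l) + cnorm A (t k \<ominus> m)" for k
    proof -
      have "s k \<oplus> t k \<ominus> (l \<oplus> m) = (s k \<ominus> l) \<oplus> (t k \<ominus> m)"
        using C(1)[of k] C(2) C(4)[of k] C(5) by algebra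
      then show ?thesis using C cnorm_triangle by simp
    qed
    show "(\<lambda>k. cnorm A (s k \<ominus> l) + cnorm A (t k \<ominus> m)) \<longlonglongrightarrow> 0"
      using tendsto_add[OF C(3,6)] by simp
  qed (use C in auto)
qed

lemma conv_mult:
  assumes "conv s l" "conv t m"
  shows "conv (\<lambda>k. s k \<otimes> t k) (l \<otimes> m)"
proof -
  note C = convD[OF assms(1)] convD[OF assms(2)]
  show ?thesis
  proof (rule convI)
    show "cnorm A (s k \<otimes> t k \<ominus> l \<otimes> m)
      \<le> cnorm A (s k) * cnorm A (t k \<ominus> m) + cnorm A (s k \<ominus> l) * cnorm A m" for k
    proof -
      have "s k \<otimes> t k \<ominus> l \<otimes> m = s k \<otimes> (t k \<ominus> m) \<oplus> (s k \<ominus> l) \<otimes> m"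
        using C(1)[of k] C(2) C(4)[of k] C(5) by algebra
      then have "cnorm A (s k \<otimes> t k \<ominus> l \<otimes> m)
        \<le> cnorm A (s k \<otimes> (t k \<ominus> m)) + cnorm A ((s k \<ominus> l) \<otimes> m)"
        using C cnorm_triangle by simp
      also have "\<dots> \<le> cnorm A (s k) * cnorm A (t k \<ominus> m) + cnorm A (s k \<ominus> l) * cnorm A m"
        using C by (intro add_mono cnorm_mult) auto
      finally show ?thesis .
    qed
    show "(\<lambda>k. cnorm A (s k) * cnorm A (t k \<ominus> m) + cnorm A (s k \<ominus> l) * cnorm A m) \<longlonglongrightarrow> 0"
      using tendsto_add[OF tendsto_mult[OF conv_cnorm[OF assms(1)] C(6)]
          tendsto_mult_right[OF C(3), of "cnorm A m"]] by simp
  qed (use C in auto)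
qed

lemma conv_smult:
  assumes "conv s l"
  shows "conv (\<lambda>k. c \<odot> s k) (c \<odot> l)"
  using conv_mult[OF conv_const[OF smult_closed[OF one_closed, of c]] assms] convD[OF assms] by simp

lemma conv_star:
  assumes "conv s l"
  shows "conv (\<lambda>k. star A (s k)) (star A l)"
  using convD[OF assms] by (auto simp: conv_def simp flip: star_diff)

lemma conv_geometric:
  assumes s: "\<And>k. s k \<in> carrier A" and step: "\<And>k. cnorm A (s (Suc k) \<ominus> s k) \<le> (1 / 2) ^ k"
  shows "\<exists>l. conv s l"
proof (rule cauchy_conv[OF s])
  \<comment> \<open>The subtracted term makes the bound telescope: it drops from \<open>m\<close> to
    \<open>m + 1\<close> by exactly \<open>(1 / 2) ^ m\<close>.\<close>
  have tail: "cnorm A (s m \<ominus> s n) \<le> 2 * (1 / 2) ^ n - 2 * (1 / 2) ^ m" if "n \<le> m" for m n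
    using that
  proof (induction m rule: dec_induct)
    case (step m)
    then show ?case
      using cnorm_diff_triangle[OF s[of "Suc m"] s[of m] s[of n]] assms(2)[of m] by simp
  qed (use s in simp)
  fix \<epsilon> :: real assume "\<epsilon> > 0"
  then obtain N where N: "(1 / 2) ^ N < \<epsilon> / 2" using real_arch_pow_inv[of "\<epsilon> / 2" "1 / 2"] by auto
  have "cnorm A (s m \<ominus> s n) < \<epsilon>" if "m \<ge> N" "n \<ge> N" "n \<le> m" for m n
  proof -
    have "cnorm A (s m \<ominus> s n) \<le> 2 * (1 / 2) ^ n"
      using tail[OF that(3)] by (smt (verit) zero_le_power divide_nonneg_nonneg)
    also have "\<dots> \<le> 2 * (1 / 2) ^ N" using that by (simp add: power_decreasing)
    finally show ?thesis using N by simp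
  qed
  then show "\<exists>N. \<forall>m\<ge>N. \<forall>n\<ge>N. cnorm A (s m \<ominus> s n) < \<epsilon>"
    using cnorm_diff_commute[OF s s] by (metis nat_le_linear)
qed

text \<open>The square root of \<open>1 - star a * a\<close> is \<open>1 - y\<close>, where \<open>y\<close> is the fixed point of the
  contraction sending \<open>y\<close> to \<open>(star a * a + y\<^sup>2) / 2\<close>.\<close>

lemma sum_squares_eq_one:
  assumes a: "a \<in> carrier A" "cnorm A a \<le> 1 / 2"
  shows "\<exists>c\<in>carrier A. star A a \<otimes> a \<oplus> star A c \<otimes> c = \<one>"
proof -
  define h where "h = star A a \<otimes> a"
  have h: "h \<in> carrier A" "star A h = h" using a by (auto simp: h_def star_mult)
  have "cnorm A h \<le> (1 / 2)\<^sup>2"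
    using a by (simp add: h_def cstar_identity power_mono del: power_divide)
  then have h_norm: "cnorm A h \<le> 1 / 4" by (simp add: power2_eq_square)
  define s where "s = rec_nat \<zero> (\<lambda>_ y. (1 / 2) \<odot> (h \<oplus> y \<otimes> y))"
  have s_simps: "s 0 = \<zero>" "\<And>k. s (Suc k) = (1 / 2) \<odot> (h \<oplus> s k \<otimes> s k)" by (auto simp: s_def)
  have sA: "s k \<in> carrier A" for k by (induction k) (auto simp: s_simps h)
  have s_star: "star A (s k) = s k" for k
    by (induction k) (auto simp: s_simps h sA star_smult star_add star_mult)
  \<comment> \<open>On the ball of radius 1/2 squaring has Lipschitz constant at most 1, so the
    factor 1/2 in the recursion makes it a contraction.\<close>
  have s_norm: "cnorm A (s k) \<le> 1 / 2" for k
  proof (induction k)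
    case (Suc k)
    have "cnorm A (s (Suc k)) \<le> 1 / 2 * (cnorm A h + cnorm A (s k \<otimes> s k))"
      using cnorm_triangle[of h "s k \<otimes> s k"] h sA by (simp add: s_simps cnorm_smult)
    also have "\<dots> \<le> 1 / 2 * (1 / 4 + 1 / 2 * (1 / 2))"
      using h_norm order.trans[OF cnorm_mult[OF sA sA] mult_mono[OF Suc Suc]] sA
      by (intro mult_left_mono add_mono) auto
    finally show ?case by simp
  qed (simp add: s_simps)
  have "cnorm A (s (Suc k) \<ominus> s k) \<le> (1 / 2) ^ k" for k
  proof (induction k)
    case 0
    show ?case using s_norm[of 1] sA[of 1] by (simp add: s_simps(1) minus_eq)
  next
    case (Suc k)
    define x where "x = s (Suc k)"
    define y where "y = s k"
    have xy: "x \<in> carrier A" "y \<in> carrier A" "cnorm A x \<le> 1 / 2" "cnorm A y \<le> 1 / 2"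
      using sA s_norm by (auto simp: x_def y_def)
    have "x \<otimes> x \<ominus> y \<otimes> y = x \<otimes> (x \<ominus> y) \<oplus> (x \<ominus> y) \<otimes> y"
      using xy(1,2) by algebra
    then have "cnorm A (x \<otimes> x \<ominus> y \<otimes> y) \<le> cnorm A (x \<otimes> (x \<ominus> y)) + cnorm A ((x \<ominus> y) \<otimes> y)"
      using xy cnorm_triangle by simp
    also have "\<dots> \<le> 1 / 2 * cnorm A (x \<ominus> y) + cnorm A (x \<ominus> y) * (1 / 2)"
      using xy by (intro add_mono order.trans[OF cnorm_mult] mult_mono) auto
    finally have le: "cnorm A (x \<otimes> x \<ominus> y \<otimes> y) \<le> cnorm A (x \<ominus> y)" by simp
    have "(h \<oplus> x \<otimes> x) \<ominus> (h \<oplus> y \<otimes> y) = x \<otimes> x \<ominus> y \<otimes> y"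
      using h(1) xy(1,2) by algebra
    moreover have "s (Suc (Suc k)) = (1 / 2) \<odot> (h \<oplus> x \<otimes> x)" "s (Suc k) = (1 / 2) \<odot> (h \<oplus> y \<otimes> y)"
      unfolding x_def y_def by (rule s_simps(2))+
    ultimately have "s (Suc (Suc k)) \<ominus> s (Suc k) = (1 / 2) \<odot> (x \<otimes> x \<ominus> y \<otimes> y)"
      using h xy by (simp flip: smult_diff)
    then have "cnorm A (s (Suc (Suc k)) \<ominus> s (Suc k)) = 1 / 2 * cnorm A (x \<otimes> x \<ominus> y \<otimes> y)"
      using xy by (simp add: cnorm_smult)
    also have "\<dots> \<le> 1 / 2 * (1 / 2) ^ k"
      using le Suc by (simp add: x_def y_def)
    finally show ?case by simp
  qed
  then obtain y where y: "conv s y" using conv_geometric sA by blast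
  have yA: "y \<in> carrier A" using convD[OF y] by blast
  have "conv (\<lambda>k. s (Suc k)) ((1 / 2) \<odot> (h \<oplus> y \<otimes> y))"
    unfolding s_simps by (intro conv_smult conv_add conv_mult conv_const y h)
  then have "y = (1 / 2) \<odot> (h \<oplus> y \<otimes> y)"
    using conv_Suc[OF y] conv_unique by blast
  then have "2 \<odot> y = 2 \<odot> ((1 / 2) \<odot> (h \<oplus> y \<otimes> y))" by simp
  then have yy: "y \<oplus> y = h \<oplus> y \<otimes> y"
    using yA h smult_add_left[OF yA, of 1 1] by simp
  define c where "c = \<one> \<ominus> y"
  have cA: "c \<in> carrier A" using yA by (simp add: c_def)
  have "star A y = y"
    using conv_star[OF y] y conv_unique by (simp add: s_star)
  then have star_c: "star A c = c" using yA by (simp add: c_def star_diff)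
  \<comment> \<open>\<open>(1 - y)^2 = 1 - 2 y + y^2\<close>, and the fixed point equation
    \<open>yy\<close> turns \<open>2 y\<close> into \<open>h + y^2\<close>.\<close>
  have "c \<otimes> c = (\<one> \<ominus> y) \<ominus> (y \<ominus> y \<otimes> y)"
    using yA by (simp add: c_def diff_smult l_distr r_distr smult_add_right)
  then have "(y \<oplus> y) \<oplus> c \<otimes> c = (y \<oplus> y) \<oplus> ((\<one> \<ominus> y) \<ominus> (y \<ominus> y \<otimes> y))"
    by simp
  also have "\<dots> = \<one> \<oplus> y \<otimes> y"
    using yA by algebra
  finally have "(h \<oplus> y \<otimes> y) \<oplus> c \<otimes> c = \<one> \<oplus> y \<otimes> y"
    by (simp only: yy)
  moreover have "(h \<oplus> y \<otimes> y) \<oplus> c \<otimes> c = (h \<oplus> c \<otimes> c) \<oplus> y \<otimes> y"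
    using yA h(1) cA by algebra
  ultimately have "h \<oplus> c \<otimes> c = \<one>"
    using yA h cA by (simp add: add.right_cancel[of "y \<otimes> y"])
  then show ?thesis using cA star_c by (intro bexI[of _ c]) (simp_all add: h_def)
qed

section \<open>Approximation from the finite-dimensional levels\<close>

lemma af_filtrationD:
  assumes "af_filtration A U"
  shows "cstar_subalgebra (U n) A" "finite_dim (U n) A" "m \<le> n \<Longrightarrow> U m \<subseteq> U n"
  using assms by (auto simp: af_filtration_def incseq_def)

lemma af_dense:
  assumes U: "af_filtration A U" and a: "a \<in> carrier A"
  shows "\<exists>s. (\<forall>k. s k \<in> (\<Union>n. U n)) \<and> conv s a"
proof -
  interpret M: Metric_space "carrier A" "cdist A" by (rule Metric_space_cdist)
  have "a \<in> M.mtopology closure_of (\<Union>n. U n)"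
    using U a by (simp add: af_filtration_def cstar_topology_def)
  then have "\<forall>r>0. \<exists>y\<in>(\<Union>n. U n). y \<in> carrier A \<and> cdist A a y < r"
    by (simp add: M.metric_closure_of M.in_mball a)
  then have "\<forall>k. \<exists>y\<in>(\<Union>n. U n). y \<in> carrier A \<and> cdist A a y < 1 / real (Suc k)"
    by (metis of_nat_0_less_iff zero_less_Suc zero_less_divide_1_iff)
  then obtain s where s: "\<And>k. s k \<in> (\<Union>n. U n)" "\<And>k. s k \<in> carrier A"
    "\<And>k. cdist A a (s k) < 1 / real (Suc k)"
    by metis
  have "conv s a"
  proof (rule convI)
    show "cnorm A (s k \<ominus> a) \<le> 1 / real (Suc k)" for k
      using s(2,3)[of k] a by (simp add: cdist_def cnorm_diff_commute[of a])
    show "(\<lambda>k. 1 / real (Suc k)) \<longlonglongrightarrow> 0"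
      using LIMSEQ_Suc[OF lim_1_over_n] by simp
  qed (use s a in auto)
  with s(1) show ?thesis by blast
qed

text \<open>Both sides depend continuously on \<open>x\<close> and \<open>d\<close>. Approximants of
  the two may come from different levels, but the filtration is increasing, so a common level
  contains both.\<close>

lemma af_cnorm_sum_squares:
  assumes U: "af_filtration A U" and x: "x \<in> carrier A" and d: "d \<in> carrier A"
  shows "(cnorm A x)\<^sup>2 \<le> cnorm A (star A x \<otimes> x \<oplus> star A d \<otimes> d)"
proof -
  note D = af_filtrationD[OF U]
  obtain s where s: "\<And>k. s k \<in> (\<Union>n. U n)" "conv s x" using af_dense[OF U x] by blast
  obtain t where t: "\<And>k. t k \<in> (\<Union>n. U n)" "conv t d" using af_dense[OF U d] by blast
  have "(cnorm A (s k))\<^sup>2 \<le> cnorm A (star A (s k) \<otimes> s k \<oplus> star A (t k) \<otimes> t k)" for k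
  proof -
    obtain m n where "s k \<in> U m" "t k \<in> U n" using s(1)[of k] t(1)[of k] by blast
    then have "s k \<in> U (max m n)" "t k \<in> U (max m n)"
      using D(3)[of m "max m n"] D(3)[of n "max m n"] by auto
    then show ?thesis using finite_dim_cnorm_sum_squares D(1,2) by blast
  qed
  moreover have "(\<lambda>k. (cnorm A (s k))\<^sup>2) \<longlonglongrightarrow> (cnorm A x)\<^sup>2"
    by (intro tendsto_power conv_cnorm s)
  moreover have "(\<lambda>k. cnorm A (star A (s k) \<otimes> s k \<oplus> star A (t k) \<otimes> t k))
      \<longlonglongrightarrow> cnorm A (star A x \<otimes> x \<oplus> star A d \<otimes> d)"
    by (intro conv_cnorm conv_add conv_mult conv_star s t)
  ultimately show ?thesis by (intro LIMSEQ_le) auto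
qed

end

section \<open>Monomorphisms between AF algebras\<close>

locale cstar_mono = A: cstar A + B: cstar B for A :: "'a cstar" and B :: "'b cstar" +
  fixes \<psi> :: "'a \<Rightarrow> 'b"
  assumes mono: "unital_star_mono A B \<psi>"
begin

lemma hom_closed [simp, intro]: "a \<in> carrier A \<Longrightarrow> \<psi> a \<in> carrier B"
  and hom_add: "a \<in> carrier A \<Longrightarrow> b \<in> carrier A \<Longrightarrow> \<psi> (a \<oplus>\<^bsub>A\<^esub> b) = \<psi> a \<oplus>\<^bsub>B\<^esub> \<psi> b"
  and hom_mult: "a \<in> carrier A \<Longrightarrow> b \<in> carrier A \<Longrightarrow> \<psi> (a \<otimes>\<^bsub>A\<^esub> b) = \<psi> a \<otimes>\<^bsub>B\<^esub> \<psi> b"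
  and hom_one [simp]: "\<psi> \<one>\<^bsub>A\<^esub> = \<one>\<^bsub>B\<^esub>"
  and hom_smult: "a \<in> carrier A \<Longrightarrow> \<psi> (c \<odot>\<^bsub>A\<^esub> a) = c \<odot>\<^bsub>B\<^esub> \<psi> a"
  and hom_star: "a \<in> carrier A \<Longrightarrow> \<psi> (star A a) = star B (\<psi> a)"
  and hom_inj: "inj_on \<psi> (carrier A)"
  using mono unfolding unital_star_mono_def unital_star_hom_def
  by (auto dest: ring_hom_closed ring_hom_add ring_hom_mult ring_hom_one)

lemma hom_zero [simp]: "\<psi> \<zero>\<^bsub>A\<^esub> = \<zero>\<^bsub>B\<^esub>"
  using hom_smult[of "\<zero>\<^bsub>A\<^esub>" 0] by simp

lemma hom_diff: "a \<in> carrier A \<Longrightarrow> b \<in> carrier A \<Longrightarrow> \<psi> (a \<ominus>\<^bsub>A\<^esub> b) = \<psi> a \<ominus>\<^bsub>B\<^esub> \<psi> b"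
  by (simp add: A.diff_smult B.diff_smult hom_add hom_smult)

lemma hom_eq_zero: "a \<in> carrier A \<Longrightarrow> \<psi> a = \<zero>\<^bsub>B\<^esub> \<longleftrightarrow> a = \<zero>\<^bsub>A\<^esub>"
  using inj_onD[OF hom_inj, of a "\<zero>\<^bsub>A\<^esub>"] by auto

text \<open>The C*-identity reduces the claim to \<open>h = star a * a\<close>. An eigenvector
  bounds the modulus of its eigenvalue by the norm of \<open>h\<close> in whichever algebra the
  equation is read; injectivity keeps it nonzero after transport and carries the equation back from
  \<open>B\<close> to \<open>A\<close>.\<close>

lemma finite_dim_isometry:
  assumes S: "finite_dim S A" "cstar_subalgebra S A"
    and T: "finite_dim (\<psi> ` S) B" "cstar_subalgebra (\<psi> ` S) B"
    and a: "a \<in> S"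
  shows "cnorm B (\<psi> a) = cnorm A a"
proof -
  note subA = A.subalgebraD[OF S(2)]
  define h where "h = star A a \<otimes>\<^bsub>A\<^esub> a"
  have aA: "a \<in> carrier A" using a subA by blast
  have h: "h \<in> S" "h \<in> carrier A" "star A h = h"
    using a subA aA by (auto simp: h_def A.star_mult)
  have hB: "\<psi> h \<in> \<psi> ` S" "star B (\<psi> h) = \<psi> h" using h by (auto simp flip: hom_star)
  have "cnorm A h \<le> cnorm B (\<psi> h)"
  proof -
    obtain l e where e: "e \<in> S" "e \<noteq> \<zero>\<^bsub>A\<^esub>" "h \<otimes>\<^bsub>A\<^esub> e = l \<odot>\<^bsub>A\<^esub> e" "cnorm A h \<le> cmod l"
      using A.norm_eigenprojection[OF S h(1,3)] by blast
    have eA: "e \<in> carrier A" using e subA by blast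
    have pos: "0 < cnorm B (\<psi> e)"
      using eA e(2) hom_eq_zero B.cnorm_eq_zero B.cnorm_nonneg by (metis hom_closed less_eq_real_def)
    have "\<psi> h \<otimes>\<^bsub>B\<^esub> \<psi> e = l \<odot>\<^bsub>B\<^esub> \<psi> e"
      using e(3) eA h by (metis hom_mult hom_smult)
    then have "cmod l * cnorm B (\<psi> e) \<le> cnorm B (\<psi> h) * cnorm B (\<psi> e)"
      using eA h by (metis B.cnorm_mult B.cnorm_smult hom_closed)
    then have "cmod l \<le> cnorm B (\<psi> h)" using pos by simp
    then show ?thesis using e by simp
  qed
  moreover have "cnorm B (\<psi> h) \<le> cnorm A h"
  proof -
    obtain l e where e: "e \<in> S" "\<psi> e \<noteq> \<zero>\<^bsub>B\<^esub>" "\<psi> h \<otimes>\<^bsub>B\<^esub> \<psi> e = l \<odot>\<^bsub>B\<^esub> \<psi> e"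
      "cnorm B (\<psi> h) \<le> cmod l"
      using B.norm_eigenprojection[OF T hB] by blast
    have eA: "e \<in> carrier A" using e subA by blast
    have pos: "0 < cnorm A e"
      using eA e(2) hom_eq_zero A.cnorm_eq_zero A.cnorm_nonneg by (metis less_eq_real_def)
    have "\<psi> (h \<otimes>\<^bsub>A\<^esub> e) = \<psi> (l \<odot>\<^bsub>A\<^esub> e)"
      using e(3) eA h by (simp add: hom_mult hom_smult)
    then have "h \<otimes>\<^bsub>A\<^esub> e = l \<odot>\<^bsub>A\<^esub> e"
      using inj_onD[OF hom_inj] eA h by simp
    then have "cmod l * cnorm A e \<le> cnorm A h * cnorm A e"
      using eA h by (metis A.cnorm_mult A.cnorm_smult)
    then have "cmod l \<le> cnorm A h" using pos by simp
    then show ?thesis using e by simp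
  qed
  ultimately have "(cnorm B (\<psi> a))\<^sup>2 = (cnorm A a)\<^sup>2"
    using A.cstar_identity[OF aA] B.cstar_identity[of "\<psi> a"] aA
    by (simp add: h_def hom_mult hom_star)
  then show ?thesis using aA by (simp add: power2_eq_iff_nonneg)
qed

lemma bounded:
  assumes V: "af_filtration B V" and a: "a \<in> carrier A"
  shows "cnorm B (\<psi> a) \<le> 2 * cnorm A a"
proof (cases "a = \<zero>\<^bsub>A\<^esub>")
  case False
  then have pos: "0 < cnorm A a" using a A.cnorm_eq_zero A.cnorm_nonneg by (metis less_eq_real_def)
  \<comment> \<open>This scales \<open>a\<close> to norm exactly 1/2, the radius allowed by
    \<open>sum_squares_eq_one\<close>; the bound 1 on the image of \<open>b\<close> then becomes the
    factor 2.\<close>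
  define t where "t = 1 / (2 * cnorm A a)"
  define b where "b = complex_of_real t \<odot>\<^bsub>A\<^esub> a"
  have b: "b \<in> carrier A" "cnorm A b \<le> 1 / 2"
    using a pos by (auto simp: b_def t_def A.cnorm_smult norm_divide norm_mult)
  obtain c where c: "c \<in> carrier A" "star A b \<otimes>\<^bsub>A\<^esub> b \<oplus>\<^bsub>A\<^esub> star A c \<otimes>\<^bsub>A\<^esub> c = \<one>\<^bsub>A\<^esub>"
    using A.sum_squares_eq_one[OF b] by blast
  have "star B (\<psi> b) \<otimes>\<^bsub>B\<^esub> \<psi> b \<oplus>\<^bsub>B\<^esub> star B (\<psi> c) \<otimes>\<^bsub>B\<^esub> \<psi> c
      = \<psi> (star A b \<otimes>\<^bsub>A\<^esub> b \<oplus>\<^bsub>A\<^esub> star A c \<otimes>\<^bsub>A\<^esub> c)"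
    using b c(1) by (simp add: hom_mult hom_star hom_add)
  then have "(cnorm B (\<psi> b))\<^sup>2 \<le> 1"
    using B.af_cnorm_sum_squares[OF V, of "\<psi> b" "\<psi> c"] b c by simp
  then have "cnorm B (\<psi> b) \<le> 1"
    using b B.cnorm_nonneg[of "\<psi> b"] by (simp add: abs_square_le_1)
  moreover have "cnorm B (\<psi> b) = t * cnorm B (\<psi> a)"
    using a pos by (simp add: b_def hom_smult B.cnorm_smult t_def norm_divide norm_mult)
  ultimately show ?thesis using pos by (simp add: t_def field_simps)
qed (use a in simp)

lemma conv_hom:
  assumes V: "af_filtration B V" and s: "A.conv s l"
  shows "B.conv (\<lambda>k. \<psi> (s k)) (\<psi> l)"
proof (rule B.convI)
  show "cnorm B (\<psi> (s k) \<ominus>\<^bsub>B\<^esub> \<psi> l) \<le> 2 * cnorm A (s k \<ominus>\<^bsub>A\<^esub> l)" for k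
    using A.convD[OF s] bounded[OF V, of "s k \<ominus>\<^bsub>A\<^esub> l"] by (simp flip: hom_diff)
  show "(\<lambda>k. 2 * cnorm A (s k \<ominus>\<^bsub>A\<^esub> l)) \<longlonglongrightarrow> 0"
    using tendsto_mult_left[OF A.convD(3)[OF s], of 2] by simp
qed (use A.convD[OF s] in auto)

text \<open>\<open>bounded\<close> makes the images of an approximating sequence converge to
  \<open>\<psi> a\<close>, so both norms are limits of the same real sequence.\<close>

lemma af_isometry:
  assumes U: "af_filtration A U" and V: "af_filtration B V" and UV: "\<And>n. \<psi> ` U n = V n"
    and a: "a \<in> carrier A"
  shows "cnorm B (\<psi> a) = cnorm A a"
proof -
  obtain s where s: "\<And>k. s k \<in> (\<Union>n. U n)" "A.conv s a"
    using A.af_dense[OF U a] by blast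
  have "cnorm B (\<psi> (s k)) = cnorm A (s k)" for k
    using finite_dim_isometry[of "U n" "s k" for n] s(1)[of k] A.af_filtrationD[OF U] B.af_filtrationD[OF V]
    by (auto simp: UV)
  then have "(\<lambda>k. cnorm A (s k)) \<longlonglongrightarrow> cnorm B (\<psi> a)"
    using B.conv_cnorm[OF conv_hom[OF V s(2)]] by simp
  then show ?thesis using A.conv_cnorm[OF s(2)] LIMSEQ_unique by blast
qed

text \<open>The image contains the dense union of the \<open>V n\<close> and is complete: a sequence
  there converging to \<open>b\<close> has a Cauchy sequence of preimages by isometry, and
  \<open>\<psi>\<close> sends their limit to \<open>b\<close>.\<close>

lemma af_surjective:
  assumes U: "af_filtration A U" and V: "af_filtration B V" and UV: "\<And>n. \<psi> ` U n = V n"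
  shows "\<psi> ` carrier A = carrier B"
proof
  show "carrier B \<subseteq> \<psi> ` carrier A"
  proof
    fix b assume "b \<in> carrier B"
    then obtain t where t: "\<And>k. t k \<in> (\<Union>n. V n)" "B.conv t b"
      using B.af_dense[OF V] by blast
    have "(\<Union>n. V n) \<subseteq> \<psi> ` carrier A"
      using A.subalgebraD(1)[OF A.af_filtrationD(1)[OF U]] by (auto simp flip: UV)
    then have "\<forall>k. \<exists>a\<in>carrier A. t k = \<psi> a" using t(1) by blast
    then obtain s where s: "\<And>k. s k \<in> carrier A" "\<And>k. t k = \<psi> (s k)" by metis
    have iso: "cnorm A (s m \<ominus>\<^bsub>A\<^esub> s n) = cnorm B (t m \<ominus>\<^bsub>B\<^esub> t n)" for m n
      using s af_isometry[OF U V UV, of "s m \<ominus>\<^bsub>A\<^esub> s n"] by (simp add: hom_diff)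
    have "\<exists>a. A.conv s a"
    proof (rule A.cauchy_conv[OF s(1)])
      fix \<epsilon> :: real assume "\<epsilon> > 0"
      then obtain N where N: "\<And>k. k \<ge> N \<Longrightarrow> cnorm B (t k \<ominus>\<^bsub>B\<^esub> b) < \<epsilon> / 2"
        using LIMSEQ_D[OF B.convD(3)[OF t(2)], of "\<epsilon> / 2"] B.convD[OF t(2)] by auto
      have "cnorm A (s m \<ominus>\<^bsub>A\<^esub> s n) < \<epsilon>" if "m \<ge> N" "n \<ge> N" for m n
        using N[OF that(1)] N[OF that(2)] B.convD[OF t(2)]
          B.cnorm_diff_triangle[of "t m" b "t n"] B.cnorm_diff_commute[of b "t n"]
        by (simp add: iso)
      then show "\<exists>N. \<forall>m\<ge>N. \<forall>n\<ge>N. cnorm A (s m \<ominus>\<^bsub>A\<^esub> s n) < \<epsilon>" by blast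
    qed
    then obtain a where a: "A.conv s a" by blast
    have "B.conv t (\<psi> a)" using conv_hom[OF V a] by (simp flip: s(2))
    then have "b = \<psi> a" using t(2) B.conv_unique by blast
    then show "b \<in> \<psi> ` carrier A" using A.convD[OF a] by blast
  qed
qed auto

end

section \<open>States of AF algebras\<close>

context cstar
begin

text \<open>Subtraction in the restricted record uses an inverse chosen inside \<open>S\<close>, so
  it agrees with that of \<open>A\<close> only by uniqueness of additive inverses.\<close>

lemma minus_subalgebra:
  assumes "cstar_subalgebra S A" "a \<in> S" "b \<in> S"
  shows "a \<ominus>\<^bsub>A\<lparr>carrier := S\<rparr>\<^esub> b = a \<ominus> b"
proof -
  note sub = subalgebraD[OF assms(1)]
  interpret S: ring "A\<lparr>carrier := S\<rparr>"
    using assms(1) subring_is_ring by (simp add: cstar_subalgebra_def)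
  have "(-1) \<odot> b \<oplus> b = \<zero>" using assms sub by (metis l_neg uminus_smult)
  then have "\<ominus>\<^bsub>A\<lparr>carrier := S\<rparr>\<^esub> b = (-1) \<odot> b"
    using assms sub by (intro S.minus_equality) auto
  then show ?thesis using assms sub by (simp add: S.minus_eq diff_smult)
qed

text \<open>The algebraic laws are inherited; completeness holds because \<open>S\<close> is closed
  in a complete space and \<open>cdist\<close> agrees on \<open>S\<close>.\<close>

lemma cstar_algebra_subalgebra:
  assumes S: "cstar_subalgebra S A"
  shows "cstar_algebra (A\<lparr>carrier := S\<rparr>)"
proof -
  note sub = subalgebraD[OF S]
  have S_ring: "ring (A\<lparr>carrier := S\<rparr>)"
    using S subring_is_ring by (simp add: cstar_subalgebra_def)
  interpret S: ring "A\<lparr>carrier := S\<rparr>" by (rule S_ring)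
  interpret M: Metric_space "carrier A" "cdist A" by (rule Metric_space_cdist)
  have cdist_eq: "cdist (A\<lparr>carrier := S\<rparr>) a b = cdist A a b" if "a \<in> S" "b \<in> S" for a b
    using that sub(4) by (simp add: cdist_def minus_subalgebra[OF S])
  have S_metric: "Metric_space S (cdist (A\<lparr>carrier := S\<rparr>))"
  proof
    show "0 \<le> cdist (A\<lparr>carrier := S\<rparr>) x y" for x y
      by (cases "x \<in> S \<and> y \<in> S") (auto simp: cdist_eq, auto simp: cdist_def)
    show "cdist (A\<lparr>carrier := S\<rparr>) x y = cdist (A\<lparr>carrier := S\<rparr>) y x" for x y
      by (cases "x \<in> S \<and> y \<in> S") (auto simp: cdist_eq M.commute, auto simp: cdist_def)
    show "cdist (A\<lparr>carrier := S\<rparr>) x y = 0 \<longleftrightarrow> x = y" if "x \<in> S" "y \<in> S" for x y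
      using that sub by (simp add: cdist_eq)
    show "cdist (A\<lparr>carrier := S\<rparr>) x z \<le> cdist (A\<lparr>carrier := S\<rparr>) x y + cdist (A\<lparr>carrier := S\<rparr>) y z"
      if "x \<in> S" "y \<in> S" "z \<in> S" for x y z
      using that sub M.triangle by (simp add: cdist_eq)
  qed
  interpret N: Metric_space S "cdist (A\<lparr>carrier := S\<rparr>)" by (rule S_metric)
  have "N.mcomplete"
    unfolding N.mcomplete_def
  proof (intro allI impI)
    fix s assume s: "N.MCauchy s"
    then have sS: "\<And>k. s k \<in> S" by (auto simp: N.MCauchy_def)
    have "M.MCauchy s"
      using s sS sub unfolding N.MCauchy_def M.MCauchy_def by (auto simp: cdist_eq)
    then obtain l where l: "limitin M.mtopology s l sequentially"
      using mcomplete_A by (auto simp: M.mcomplete_def)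
    have "closedin M.mtopology S" using S by (simp add: cstar_subalgebra_def cstar_topology_def)
    moreover have "range s \<subseteq> S" using sS by auto
    ultimately have "l \<in> S"
      using l M.metric_closedin_iff_sequentially_closed[of S] by blast
    then have "limitin N.mtopology s l sequentially"
      using l sS by (simp add: M.limitin_metric_dist_null N.limitin_metric_dist_null cdist_eq)
    then show "\<exists>l. limitin N.mtopology s l sequentially" by blast
  qed
  moreover have "Module.module (ring_of_type_algebra :: complex ring) (A\<lparr>carrier := S\<rparr>)"
    using sub module.axioms(1)[OF module_A] S.is_abelian_group
    by (intro moduleI)
      (auto simp: ring_of_type_algebra_def smult_add_left smult_add_right)
  ultimately show ?thesis
    unfolding cstar_algebra_def cstar_algebra_axioms_def
    using S_ring sub
    by (auto simp: star_add star_smult star_mult cnorm_smult cnorm_triangle cnorm_mult cstar_identity)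
qed

lemma states_restrict:
  assumes S: "cstar_subalgebra S A" and f: "f \<in> states A"
  shows "restrict f S \<in> states (A\<lparr>carrier := S\<rparr>)"
  using f subalgebraD[OF S] by (auto simp: states_def)

text \<open>Minimal projections \<open>p n\<close> of the \<open>U n\<close> that decrease in \<open>n\<close> define a state \<open>f\<close> by
  \<open>p n b p n = f b p n\<close> for \<open>b\<close> in \<open>U n\<close>. On the whole algebra this holds in the limit.\<close>

lemma af_states_nonempty:
  assumes U: "af_filtration A U"
  shows "states A \<noteq> {}"
proof -
  note D = af_filtrationD[OF U]
  note sub = subalgebraD[OF D(1)]
  have "\<exists>p. \<forall>n. minimal_projection (U n) (p n) \<and> p n \<otimes> p (Suc n) = p (Suc n)"
  proof (rule dependent_nat_choice)
    show "\<exists>p. minimal_projection (U 0) p"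
      using minimal_projection_below[OF D(2,1) sub(3) projection_one] by auto
    \<comment> \<open>In the larger \<open>U (Suc n)\<close> the projection \<open>p\<close> may no
      longer be minimal, so a minimal one below it is chosen.\<close>
    show "\<exists>q. minimal_projection (U (Suc n)) q \<and> p \<otimes> q = q" if "minimal_projection (U n) p" for p n
      using that D(3)[of n "Suc n"] minimal_projection_below[OF D(2,1), of p "Suc n"]
      by (auto simp: minimal_projection_def)
  qed
  then obtain p where p: "\<And>n. minimal_projection (U n) (p n)"
    and p_Suc: "\<And>n. p n \<otimes> p (Suc n) = p (Suc n)" by blast
  have pA: "p n \<in> carrier A" "projection (p n)" "cnorm A (p n) = 1" "p n \<otimes> p n = p n" for n
    using p[of n] cnorm_projection by (auto simp: minimal_projection_def projection_def)
  have decr: "p m \<otimes> p n = p n" if "m \<le> n" for m n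
    using that
  proof (induction n rule: dec_induct)
    case (step n)
    then show ?case using p_Suc[of n] pA by (metis m_assoc)
  qed (use pA in simp)
  have decr': "p n \<otimes> p m = p n" if "m \<le> n" for m n
    using projection_mult_commute decr[OF that] pA by blast
  \<comment> \<open>\<open>R b l\<close> says that \<open>l\<close> is the asymptotic compression of
    \<open>b\<close>. A relation is used because existence of \<open>l\<close> is clear at first
    only on the union of the \<open>U n\<close>.\<close>
  define R where "R = (\<lambda>b l. (\<lambda>n. cnorm A (p n \<otimes> b \<otimes> p n \<ominus> l \<odot> p n)) \<longlonglongrightarrow> 0)"
  have comp: "cnorm A (p n \<otimes> b \<otimes> p n) \<le> cnorm A b" if "b \<in> carrier A" for b n
    using cnorm_mult[of "p n \<otimes> b" "p n"] cnorm_mult[of "p n" b] that pA by simp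
  have R_bound: "cmod l \<le> cnorm A b" if b: "b \<in> carrier A" and R: "R b l" for b l
  proof -
    have "cmod l \<le> cnorm A (p n \<otimes> b \<otimes> p n \<ominus> l \<odot> p n) + cnorm A b" for n
    proof -
      have "cmod l = cnorm A (l \<odot> p n)" using pA by (simp add: cnorm_smult)
      also have "\<dots> \<le> cnorm A (p n \<otimes> b \<otimes> p n \<ominus> l \<odot> p n) + cnorm A (p n \<otimes> b \<otimes> p n)"
        using abs_cnorm_diff_le[of "p n \<otimes> b \<otimes> p n" "l \<odot> p n"] b pA by simp
      finally show ?thesis using comp[OF b, of n] by simp
    qed
    moreover have "(\<lambda>n. cnorm A (p n \<otimes> b \<otimes> p n \<ominus> l \<odot> p n) + cnorm A b) \<longlonglongrightarrow> 0 + cnorm A b"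
      using R unfolding R_def by (intro tendsto_intros)
    ultimately show ?thesis using LIMSEQ_le_const by fastforce
  qed
  have R_add: "R (b \<oplus> b') (l + l')"
    if b: "b \<in> carrier A" "b' \<in> carrier A" and R: "R b l" "R b' l'" for b b' l l'
    unfolding R_def
  proof (rule tendsto_sandwich[OF _ _ tendsto_const])
    show "(\<lambda>n. cnorm A (p n \<otimes> b \<otimes> p n \<ominus> l \<odot> p n) + cnorm A (p n \<otimes> b' \<otimes> p n \<ominus> l' \<odot> p n)) \<longlonglongrightarrow> 0"
      using tendsto_add[OF R[unfolded R_def]] by simp
    have "p n \<otimes> (b \<oplus> b') \<otimes> p n \<ominus> (l + l') \<odot> p n
        = (p n \<otimes> b \<otimes> p n \<ominus> l \<odot> p n) \<oplus> (p n \<otimes> b' \<otimes> p n \<ominus> l' \<odot> p n)" for n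
      using b pA(1)[of n] smult_closed[OF pA(1)[of n], of l] smult_closed[OF pA(1)[of n], of l']
      unfolding smult_add_left[OF pA(1)] by algebra
    then show "\<forall>\<^sub>F n in sequentially. cnorm A (p n \<otimes> (b \<oplus> b') \<otimes> p n \<ominus> (l + l') \<odot> p n)
        \<le> cnorm A (p n \<otimes> b \<otimes> p n \<ominus> l \<odot> p n) + cnorm A (p n \<otimes> b' \<otimes> p n \<ominus> l' \<odot> p n)"
      using b pA cnorm_triangle by simp
  qed (use b pA in auto)
  have R_smult: "R (c \<odot> b) (c * l)" if b: "b \<in> carrier A" and R: "R b l" for b c l
  proof -
    have "p n \<otimes> (c \<odot> b) \<otimes> p n \<ominus> (c * l) \<odot> p n = c \<odot> (p n \<otimes> b \<otimes> p n \<ominus> l \<odot> p n)" for n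
      using b pA by (simp add: smult_diff)
    then have "cnorm A (p n \<otimes> (c \<odot> b) \<otimes> p n \<ominus> (c * l) \<odot> p n)
        = cmod c * cnorm A (p n \<otimes> b \<otimes> p n \<ominus> l \<odot> p n)" for n
      using b pA by (simp add: cnorm_smult)
    then show ?thesis
      using tendsto_mult_left[OF R[unfolded R_def], of "cmod c"] by (simp add: R_def)
  qed
  \<comment> \<open>With \<open>b = b'\<close> this gives uniqueness of \<open>l\<close>; in general
    it makes the future state 1-Lipschitz, hence continuous.\<close>
  have R_diff: "cmod (l - l') \<le> cnorm A (b \<ominus> b')"
    if b: "b \<in> carrier A" "b' \<in> carrier A" and R: "R b l" "R b' l'" for b b' l l'
    using R_bound[OF _ R_add[OF b(1) _ R(1) R_smult[OF b(2) R(2), of "-1"]]] b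
    by (simp add: diff_smult)
  \<comment> \<open>Compressing further by \<open>p n\<close> below \<open>p m\<close> keeps the
    scalar, so the sequence in \<open>R\<close> is eventually zero.\<close>
  have R_U: "\<exists>l. R b l \<and> p m \<otimes> b \<otimes> p m = l \<odot> p m" if b: "b \<in> U m" for b m
  proof -
    obtain l where l: "p m \<otimes> b \<otimes> p m = l \<odot> p m" using p[of m] b by (auto simp: minimal_projection_def)
    have bA: "b \<in> carrier A" using b sub by blast
    have "p n \<otimes> b \<otimes> p n = l \<odot> p n" if "m \<le> n" for n
    proof -
      have "p n \<otimes> b \<otimes> p n = (p n \<otimes> p m) \<otimes> b \<otimes> (p m \<otimes> p n)" using decr decr' that by simp
      also have "\<dots> = p n \<otimes> (p m \<otimes> b \<otimes> p m) \<otimes> p n" using pA bA by (simp add: m_assoc)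
      also have "\<dots> = l \<odot> p n" using l pA decr'[OF that] by simp
      finally show ?thesis .
    qed
    then have "\<forall>\<^sub>F n in sequentially. cnorm A (p n \<otimes> b \<otimes> p n \<ominus> l \<odot> p n) = 0"
      using pA r_right_minus_eq by (auto simp: eventually_sequentially intro!: exI[of _ m])
    then show ?thesis using l unfolding R_def by (blast intro: tendsto_eventually)
  qed
  have R_ex: "\<exists>l. R b l" if b: "b \<in> carrier A" for b
  proof -
    obtain s where s: "\<And>k. s k \<in> (\<Union>n. U n)" "conv s b" using af_dense[OF U b] by blast
    note sC = convD[OF s(2)]
    have "\<forall>k. \<exists>l. R (s k) l" using s(1) R_U by blast
    then obtain l where l: "\<And>k. R (s k) (l k)" by metis
    have "Cauchy l"
    proof (rule CauchyI)
      fix \<epsilon> :: real assume "\<epsilon> > 0"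
      then obtain N where N: "\<And>k. k \<ge> N \<Longrightarrow> cnorm A (s k \<ominus> b) < \<epsilon> / 2"
        using LIMSEQ_D[OF sC(3), of "\<epsilon> / 2"] sC by auto
      have "cmod (l m - l n) < \<epsilon>" if "m \<ge> N" "n \<ge> N" for m n
        using R_diff[OF sC(1) sC(1) l l, of m n] N[OF that(1)] N[OF that(2)]
          cnorm_diff_triangle[OF sC(1) b sC(1), of m n] cnorm_diff_commute[OF b sC(1), of n] by simp
      then show "\<exists>N. \<forall>m\<ge>N. \<forall>n\<ge>N. cmod (l m - l n) < \<epsilon>" by blast
    qed
    then obtain L where L: "l \<longlonglongrightarrow> L" using Cauchy_convergent convergent_def by blast
    have "R b L"
      unfolding R_def
    \<comment> \<open>Three errors of size \<open>\<epsilon> / 3\<close>: replacing \<open>b\<close>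
      by \<open>s k\<close>, the compression of \<open>s k\<close> against \<open>l k\<close>, and
      \<open>l k\<close> against \<open>L\<close>. The index \<open>k\<close> is fixed before
      \<open>n\<close>.\<close>
    proof (rule LIMSEQ_I)
      fix \<epsilon> :: real assume "\<epsilon> > 0"
      then obtain N1 where N1: "\<And>k. k \<ge> N1 \<Longrightarrow> cnorm A (s k \<ominus> b) < \<epsilon> / 3"
        using LIMSEQ_D[OF sC(3), of "\<epsilon> / 3"] sC by auto
      obtain N2 where N2: "\<And>k. k \<ge> N2 \<Longrightarrow> cmod (l k - L) < \<epsilon> / 3"
        using LIMSEQ_D[OF L, of "\<epsilon> / 3"] \<open>\<epsilon> > 0\<close> by auto
      define k where "k = max N1 N2"
      obtain N where N: "\<And>n. n \<ge> N \<Longrightarrow> cnorm A (p n \<otimes> s k \<otimes> p n \<ominus> l k \<odot> p n) < \<epsilon> / 3"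
        using LIMSEQ_D[OF l[of k, unfolded R_def], of "\<epsilon> / 3"] \<open>\<epsilon> > 0\<close> sC(1)[of k] pA by auto
      have "cnorm A (p n \<otimes> b \<otimes> p n \<ominus> L \<odot> p n) < \<epsilon>" if "n \<ge> N" for n
      proof -
        define x where "x = p n \<otimes> b \<otimes> p n"
        define y where "y = p n \<otimes> s k \<otimes> p n"
        have xy: "x \<in> carrier A" "y \<in> carrier A" using b pA sC by (auto simp: x_def y_def)
        have "y \<ominus> x = p n \<otimes> (s k \<ominus> b) \<otimes> p n"
          using b pA(1)[of n] sC(1)[of k] unfolding x_def y_def by algebra
        then have 1: "cnorm A (x \<ominus> y) < \<epsilon> / 3"
          using comp[of "s k \<ominus> b" n] N1[of k] b sC cnorm_diff_commute[OF xy] by (simp add: k_def)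
        have "l k \<odot> p n \<ominus> L \<odot> p n = (l k - L) \<odot> p n" using pA by (simp add: smult_diff_left)
        then have 2: "cnorm A (l k \<odot> p n \<ominus> L \<odot> p n) < \<epsilon> / 3"
          using pA N2[of k] by (simp add: cnorm_smult k_def)
        show ?thesis
          using 1 2 N[OF that, folded y_def] xy pA
            cnorm_diff_triangle[of x y "L \<odot> p n"] cnorm_diff_triangle[of y "l k \<odot> p n" "L \<odot> p n"]
          by (simp flip: x_def)
      qed
      then show "\<exists>N. \<forall>n\<ge>N. norm (cnorm A (p n \<otimes> b \<otimes> p n \<ominus> L \<odot> p n) - 0) < \<epsilon>"
        using b pA by auto
    qed
    then show ?thesis by blast
  qed
  define f where "f = restrict (\<lambda>b. SOME l. R b l) (carrier A)"
  have f: "R b (f b)" if "b \<in> carrier A" for b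
    using someI_ex[OF R_ex[OF that]] that by (simp add: f_def)
  have f_eq: "f b = l" if "b \<in> carrier A" "R b l" for b l
    using R_diff[OF that(1,1) f[OF that(1)] that(2)] that by (simp add: minus_eq r_neg)
  have "f (star A b \<otimes> b) \<in> \<real>\<^sub>\<ge>\<^sub>0" if b: "b \<in> carrier A" for b
  proof -
    obtain s where s: "\<And>k. s k \<in> (\<Union>n. U n)" "conv s b" using af_dense[OF U b] by blast
    note sC = convD[OF s(2)]
    have C: "conv (\<lambda>k. star A (s k) \<otimes> s k) (star A b \<otimes> b)"
      by (intro conv_mult conv_star s)
    have "f (star A (s k) \<otimes> s k) \<in> \<real>\<^sub>\<ge>\<^sub>0" for k
    proof -
      obtain m where m: "s k \<in> U m" using s(1)[of k] by blast
      then obtain l where l: "R (star A (s k) \<otimes> s k) l" "p m \<otimes> (star A (s k) \<otimes> s k) \<otimes> p m = l \<odot> p m"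
        using R_U[OF sub(8)[OF sub(5)[OF m] m]] by blast
      then show ?thesis
        using minimal_projection_positive[OF D(1) p m l(2)] f_eq[OF _ l(1)] sC by simp
    qed
    moreover have "(\<lambda>k. f (star A (s k) \<otimes> s k)) \<longlonglongrightarrow> f (star A b \<otimes> b)"
    proof (rule LIM_zero_cancel, rule tendsto_norm_zero_cancel,
        rule tendsto_sandwich[OF _ _ tendsto_const convD(3)[OF C]])
      show "\<forall>\<^sub>F k in sequentially. cmod (f (star A (s k) \<otimes> s k) - f (star A b \<otimes> b))
          \<le> cnorm A (star A (s k) \<otimes> s k \<ominus> star A b \<otimes> b)"
        using R_diff f convD[OF C] by auto
    qed auto
    ultimately show ?thesis
      by (rule closed_sequentially[OF closed_nonneg_Reals_complex])
  qed
  moreover have "R \<one> 1"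
    using pA r_right_minus_eq by (simp add: R_def)
  then have "f \<one> = 1" using f_eq by simp
  moreover have "f (b \<oplus> b') = f b + f b'" if "b \<in> carrier A" "b' \<in> carrier A" for b b'
    using that f f_eq R_add by simp
  moreover have "f (c \<odot> b) = c * f b" if "b \<in> carrier A" for b c
    using that f f_eq R_smult by simp
  moreover have "f \<in> extensional (carrier A)" by (simp add: f_def)
  ultimately have "f \<in> states A" by (simp add: states_def)
  then show ?thesis by blast
qed

end

section \<open>Quantum isometries and the propinquity\<close>

lemma SUP_ennreal_eq_zero:
  fixes f :: "'i \<Rightarrow> ennreal"
  assumes "\<And>x. x \<in> S \<Longrightarrow> f x = 0"
  shows "(SUP x\<in>S. f x) = 0"
  unfolding le_zero_eq[symmetric] using assms by (intro SUP_least) auto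

lemma hausdorff_eq_zero:
  assumes "\<And>x. x \<in> S \<Longrightarrow> \<exists>y\<in>T. d x y = 0" "\<And>y. y \<in> T \<Longrightarrow> \<exists>x\<in>S. d x y = 0"
  shows "hausdorff d S T = 0"
proof -
  have "(INF y\<in>T. d x y) = 0" if "x \<in> S" for x
    using assms(1)[OF that] by (metis INF_lower le_zero_eq)
  moreover have "(INF x\<in>S. d x y) = 0" if "y \<in> T" for y
    using assms(2)[OF that] by (metis INF_lower le_zero_eq)
  ultimately show ?thesis
    unfolding hausdorff_def by (simp only: SUP_ennreal_eq_zero max.idem)
qed

lemma hausdorff_mk_self: "hausdorff (mk M) S S = 0"
proof (rule hausdorff_eq_zero)
  have "mk M f f = 0" for f
    unfolding mk_def by (rule SUP_ennreal_eq_zero) simp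
  then show "f \<in> S \<Longrightarrow> \<exists>g\<in>S. mk M f g = 0" "f \<in> S \<Longrightarrow> \<exists>g\<in>S. mk M g f = 0" for f
    by blast+
qed

context cstar_mono
begin

lemma states_compose:
  assumes "f \<in> states B"
  shows "compose (carrier A) f \<psi> \<in> states A"
  using assms
  by (auto simp: states_def compose_eq hom_add hom_smult hom_mult hom_star compose_def extensional_def)

text \<open>Composing \<open>g\<close> with the inverse of \<open>\<psi>\<close> gives the state.
  Hence pulling back along \<open>\<psi>\<close> reaches every state of \<open>A\<close>, as a
  bridge of height zero requires.\<close>

lemma states_transport:
  assumes surj: "\<psi> ` carrier A = carrier B" and g: "g \<in> states A"
  shows "\<exists>f\<in>states B. compose (carrier A) f \<psi> = g"
proof -
  define f where "f = restrict (\<lambda>b. g (inv_into (carrier A) \<psi> b)) (carrier B)"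
  have f: "f (\<psi> a) = g a" if "a \<in> carrier A" for a
    using that hom_inj by (simp add: f_def inv_into_f_f)
  have "f \<in> states B"
    unfolding states_def mem_Collect_eq
  proof (intro conjI ballI allI)
    show "f \<in> extensional (carrier B)" by (simp add: f_def)
    show "f \<one>\<^bsub>B\<^esub> = 1" using f[of "\<one>\<^bsub>A\<^esub>"] g by (simp add: states_def)
  next
    fix b b' assume "b \<in> carrier B" "b' \<in> carrier B"
    then obtain a a' where a: "a \<in> carrier A" "b = \<psi> a" "a' \<in> carrier A" "b' = \<psi> a'"
      using surj by blast
    then have "f (b \<oplus>\<^bsub>B\<^esub> b') = g (a \<oplus>\<^bsub>A\<^esub> a')" using f[of "a \<oplus>\<^bsub>A\<^esub> a'"] by (simp add: hom_add)
    then show "f (b \<oplus>\<^bsub>B\<^esub> b') = f b + f b'" using a g f by (simp add: states_def)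
  next
    fix c b assume "b \<in> carrier B"
    then obtain a where a: "a \<in> carrier A" "b = \<psi> a" using surj by blast
    then have "f (c \<odot>\<^bsub>B\<^esub> b) = g (c \<odot>\<^bsub>A\<^esub> a)" using f[of "c \<odot>\<^bsub>A\<^esub> a"] by (simp add: hom_smult)
    then show "f (c \<odot>\<^bsub>B\<^esub> b) = c * f b" using a g f by (simp add: states_def)
  next
    fix b assume "b \<in> carrier B"
    then obtain a where a: "a \<in> carrier A" "b = \<psi> a" using surj by blast
    then have "f (star B b \<otimes>\<^bsub>B\<^esub> b) = g (star A a \<otimes>\<^bsub>A\<^esub> a)"
      using f[of "star A a \<otimes>\<^bsub>A\<^esub> a"] by (simp add: hom_mult hom_star)
    then show "f (star B b \<otimes>\<^bsub>B\<^esub> b) \<in> \<real>\<^sub>\<ge>\<^sub>0" using a g by (simp add: states_def)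
  qed
  moreover have "compose (carrier A) f \<psi> = g"
    using f g by (auto simp: compose_def states_def extensional_def)
  ultimately show ?thesis by blast
qed

lemma quotient_norm_image:
  assumes iso: "\<And>a. a \<in> carrier A \<Longrightarrow> cnorm B (\<psi> a) = cnorm A a"
    and S: "S \<subseteq> carrier A" and a: "a \<in> carrier A"
  shows "quotient_norm B (\<psi> ` S) (\<psi> a) = quotient_norm A S a"
proof -
  have "cnorm B (\<psi> a \<ominus>\<^bsub>B\<^esub> \<psi> b) = cnorm A (a \<ominus>\<^bsub>A\<^esub> b)" if "b \<in> S" for b
    using that S a iso[of "a \<ominus>\<^bsub>A\<^esub> b"] by (auto simp: hom_diff)
  then show ?thesis
    unfolding quotient_norm_def image_image by (intro INF_cong) auto
qed

end

text \<open>The bridge is the target algebra itself with pivot \<open>1\<close>, whose level states are all states.\<close>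

lemma quantum_isometry_imp_propinquity_eq_zero:
  fixes M N :: "'a space"
  assumes iso: "quantum_isometry M N \<pi>"
    and M: "cstar_algebra (fst M)" and N: "cstar_algebra (fst N)"
    and states: "states (fst N) \<noteq> {}"
  shows "propinquity C D M N = 0"
proof -
  define A where "A = fst M"
  define B where "B = fst N"
  have hom: "unital_star_hom A B \<pi>" and bij: "bij_betw \<pi> (carrier A) (carrier B)"
    and L: "\<And>a. a \<in> sa A \<Longrightarrow> snd N (\<pi> a) = snd M a"
    using iso by (auto simp: quantum_isometry_def star_iso_def A_def B_def)
  interpret cstar_mono A B \<pi>
    using M N hom bij cstar_algebra_imp_cstar
    by (auto simp: cstar_mono_def cstar_mono_axioms_def unital_star_mono_def A_def B_def bij_betw_def)
  have surj: "\<pi> ` carrier A = carrier B" using bij by (simp add: bij_betw_def)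
  have f_zero: "f \<zero>\<^bsub>B\<^esub> = 0" if "f \<in> states B" for f
  proof -
    have "f (0 \<odot>\<^bsub>B\<^esub> \<zero>\<^bsub>B\<^esub>) = 0 * f \<zero>\<^bsub>B\<^esub>" using that B.zero_closed unfolding states_def by blast
    then show ?thesis by simp
  qed
  have level: "level_states B \<one>\<^bsub>B\<^esub> = states B"
    using f_zero by (auto simp: level_states_def)
  have bridge: "bridge A B B \<pi> id \<one>\<^bsub>B\<^esub>"
    using N states mono
    by (auto simp: bridge_def level B_def[symmetric] unital_star_mono_def unital_star_hom_def ring_hom_def)
  have "compose (carrier B) f id = f" if "f \<in> states B" for f
    using that by (auto simp: compose_def states_def extensional_def)
  then have "(\<lambda>f. compose (carrier B) f id) ` states B = states B" by simp
  moreover have "(\<lambda>f. compose (carrier A) f \<pi>) ` states B = states A"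
    using states_compose states_transport[OF surj] by blast
  ultimately have height: "bridge_height M N B \<pi> id \<one>\<^bsub>B\<^esub> = 0"
    unfolding bridge_height_def A_def[symmetric] B_def[symmetric] level
    by (simp add: hausdorff_mk_self)
  \<comment> \<open>With pivot \<open>1\<close> and second embedding \<open>id\<close>, the distance
    from \<open>a\<close> to \<open>b\<close> is the norm of \<open>\<pi> a - b\<close>. It vanishes
    at \<open>b = \<pi> a\<close>, and invariance of the Lip-norm matches the two balls.\<close>
  have "bridge_reach M N B \<pi> id \<one>\<^bsub>B\<^esub> = 0"
    unfolding bridge_reach_def
  proof (rule hausdorff_eq_zero)
    fix a assume a: "a \<in> lip_ball M"
    then have aA: "a \<in> carrier A" "star A a = a" by (auto simp: lip_ball_def sa_def A_def)
    then have "\<pi> a \<in> lip_ball N"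
      using a L[of a] by (auto simp: lip_ball_def sa_def A_def[symmetric] B_def[symmetric] simp flip: hom_star)
    then show "\<exists>b\<in>lip_ball N. ennreal (cnorm B (\<pi> a \<otimes>\<^bsub>B\<^esub> \<one>\<^bsub>B\<^esub> \<ominus>\<^bsub>B\<^esub> \<one>\<^bsub>B\<^esub> \<otimes>\<^bsub>B\<^esub> id b)) = 0"
      using aA by (intro bexI[of _ "\<pi> a"]) auto
  next
    fix b assume b: "b \<in> lip_ball N"
    then have bB: "b \<in> carrier B" "star B b = b" by (auto simp: lip_ball_def sa_def B_def)
    then obtain a where a: "a \<in> carrier A" "b = \<pi> a" using surj by blast
    then have "\<pi> (star A a) = \<pi> a" using bB by (simp add: hom_star)
    then have "star A a = a" using a inj_onD[OF hom_inj] by simp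
    then have "a \<in> lip_ball M"
      using a b L[of a] by (simp add: lip_ball_def sa_def A_def[symmetric] B_def[symmetric])
    then show "\<exists>a\<in>lip_ball M. ennreal (cnorm B (\<pi> a \<otimes>\<^bsub>B\<^esub> \<one>\<^bsub>B\<^esub> \<ominus>\<^bsub>B\<^esub> \<one>\<^bsub>B\<^esub> \<otimes>\<^bsub>B\<^esub> id b)) = 0"
      using a by (intro bexI[of _ a]) auto
  qed
  then have "bridge_length M N B \<pi> id \<one>\<^bsub>B\<^esub> = 0"
    using height by (simp add: bridge_length_def)
  then have "bridge_chain C D M N 0"
    using bridge_chain.single[of M N B \<pi> id "\<one>\<^bsub>B\<^esub>" C D] bridge by (simp add: A_def B_def)
  then show ?thesis
    unfolding propinquity_def by (metis Inf_lower le_zero_eq mem_Collect_eq)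
qed

theorem theorem5p4:
  fixes A B :: "'a cstar"
    and U V :: "nat \<Rightarrow> 'a set"
    and \<beta> :: "nat \<Rightarrow> real"
    and \<psi> :: "'a \<Rightarrow> 'a"
  assumes "af_filtration A U"
    and "af_filtration B V"
    and "\<And>n. 0 < \<beta> n"
    and "\<beta> \<longlonglongrightarrow> 0"
    and "unital_star_mono A B \<psi>"
    and "\<And>n. \<psi> ` U n = V n"
  shows "quantum_isometry (A, af_lipnorm A U \<beta>) (B, af_lipnorm B V \<beta>) \<psi> \<and>
    propinquity 1 0 (A, af_lipnorm A U \<beta>) (B, af_lipnorm B V \<beta>) = 0 \<and>
    (\<forall>n. propinquity 1 0 (A\<lparr>carrier := U n\<rparr>, af_lipnorm A U \<beta>)
                         (B\<lparr>carrier := V n\<rparr>, af_lipnorm B V \<beta>) = 0)"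
proof (intro conjI allI)
  have algebras: "cstar_algebra A" "cstar_algebra B"
    using assms(1,2) by (auto simp: af_filtration_def)
  interpret cstar_mono A B \<psi>
    using assms(5) algebras cstar_algebra_imp_cstar
    by (auto simp: cstar_mono_def cstar_mono_axioms_def)
  note DA = A.af_filtrationD[OF assms(1)] and DB = B.af_filtrationD[OF assms(2)]
  have UA: "U n \<subseteq> carrier A" for n using A.subalgebraD(1)[OF DA(1)] .
  \<comment> \<open>As \<open>\<psi>\<close> is isometric and maps \<open>U n\<close> onto
    \<open>V n\<close>, the quotient norms agree term by term in the supremum.\<close>
  have L: "af_lipnorm B V \<beta> (\<psi> a) = af_lipnorm A U \<beta> a" if "a \<in> carrier A" for a
    using quotient_norm_image[OF af_isometry[OF assms(1,2,6)] UA that]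
    by (simp add: af_lipnorm_def assms(6))
  have hom: "unital_star_hom A B \<psi>" using assms(5) by (simp add: unital_star_mono_def)
  show iso: "quantum_isometry (A, af_lipnorm A U \<beta>) (B, af_lipnorm B V \<beta>) \<psi>"
    using hom hom_inj af_surjective[OF assms(1,2,6)] L
    by (auto simp: quantum_isometry_def star_iso_def bij_betw_def sa_def)
  show "propinquity 1 0 (A, af_lipnorm A U \<beta>) (B, af_lipnorm B V \<beta>) = 0"
    using quantum_isometry_imp_propinquity_eq_zero[OF iso] algebras B.af_states_nonempty[OF assms(2)] by simp
  fix n
  have "unital_star_hom (A\<lparr>carrier := U n\<rparr>) (B\<lparr>carrier := V n\<rparr>) \<psi>"
    using hom UA[of n] assms(6)[of n]
    by (auto simp: unital_star_hom_def ring_hom_def subset_iff)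
  \<comment> \<open>The Lip-norm on a level is the same function as on the whole algebra, so
    \<open>L\<close> applies unchanged; bijectivity comes from injectivity and the image
    hypothesis.\<close>
  then have iso_n: "quantum_isometry (A\<lparr>carrier := U n\<rparr>, af_lipnorm A U \<beta>)
      (B\<lparr>carrier := V n\<rparr>, af_lipnorm B V \<beta>) \<psi>"
    using inj_on_subset[OF hom_inj UA] assms(6) L UA
    by (auto simp: quantum_isometry_def star_iso_def bij_betw_def sa_def subset_iff)
  have "states (B\<lparr>carrier := V n\<rparr>) \<noteq> {}"
    using B.states_restrict[OF DB(1)] B.af_states_nonempty[OF assms(2)] by blast
  then show "propinquity 1 0 (A\<lparr>carrier := U n\<rparr>, af_lipnorm A U \<beta>)
      (B\<lparr>carrier := V n\<rparr>, af_lipnorm B V \<beta>) = 0"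
    using A.cstar_algebra_subalgebra[OF DA(1)] B.cstar_algebra_subalgebra[OF DB(1)]
    by (intro quantum_isometry_imp_propinquity_eq_zero[OF iso_n]) simp_all
qed

end
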